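(* Let $A$ be an integer with $3\nmid A$ and $A^2\not\equiv 1\pmod 9$. Then for infinitely many primes $p$ (not dividing $3A$), the ratio $\mathrm{ord}_p(A)/\mathrm{ord}_p(-3)$ is an integer multiple of $3$. Consequently, both pairs $A,-3$ and $A,3$ are order-dominant.
   Context: For a prime $p$ and a rational number $\alpha$ that is a $p$-adic unit, $\mathrm{ord}_p(\alpha)$ denotes the multiplicative order of $\alpha \bmod p$ in $\mathbb{F}_p^{\times}$. For $\alpha,\beta\in\mathbb{Q}^{\times}\setminus\{\pm1\}$, the ordered pair $\alpha,\beta$ is called order-dominant if $\mathrm{ord}_p(\alpha)>\mathrm{ord}_p(\beta)$ for infinitely many primes $p$. *)

theory Defs
  imports "HOL-Number_Theory.Number_Theory"
begin

text \<open>A rational number is a unit of the local ring of $p$-adic integers iff neither the numerator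
  nor the denominator of its reduced fraction is divisible by the prime $p$.\<close>

definition padic_unit :: "nat \<Rightarrow> rat \<Rightarrow> bool" where
  "padic_unit p \<alpha> \<longleftrightarrow>
     (case quotient_of \<alpha> of (a, b) \<Rightarrow> \<not> int p dvd a \<and> \<not> int p dvd b)"

text \<open>The class of $a/b$ in $\mathbb{F}_p$ as its representative in $\{0,\dots,p-1\}$, meaningful
  when the denominator is prime to $p$.\<close>

definition rat_residue :: "nat \<Rightarrow> rat \<Rightarrow> nat" where
  "rat_residue p \<alpha> =
     (case quotient_of \<alpha> of (a, b) \<Rightarrow> nat (a * modular_inverse (int p) b mod int p))"

text \<open>The library's \<^const>\<open>ord\<close> is the multiplicative order modulo $p$
  (with value $0$ on non-units).\<close>

definition rat_ord :: "nat \<Rightarrow> rat \<Rightarrow> nat" where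
  "rat_ord p \<alpha> = ord p (rat_residue p \<alpha>)"

text \<open>Only primes at which both numbers are units are counted, since the orders are defined only
  there; the finitely many other primes do not affect infinitude.\<close>

definition order_dominant :: "rat \<Rightarrow> rat \<Rightarrow> bool" where
  "order_dominant \<alpha> \<beta> \<longleftrightarrow>
     \<alpha> \<notin> {0, 1, -1} \<and> \<beta> \<notin> {0, 1, -1} \<and>
     infinite {p. prime p \<and> padic_unit p \<alpha> \<and> padic_unit p \<beta> \<and> rat_ord p \<alpha> > rat_ord p \<beta>}"

end

(* If 3 divides ord_p(A) and -3 is congruent to A^(12j) modulo p, then ord_p(A) / ord_p(-3) =
   gcd(12j, ord_p(A)) is a multiple of 3. So it suffices to find, for suitable j, a prime divisor p
   of B^2 + 3, B = A^(6j), modulo which A is not a cube; taking j = M! forces p > M. In the ring of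
   Eisenstein integers B^2 + 3 is the norm of B + sqrt(-3), and
   z = omega * (B + sqrt(-3)), divided by 2 if B is odd, is congruent to 1 or -1 modulo 3. Were A a
   cube modulo all prime divisors of the norm of z, cubic reciprocity would give
   1 = (A/z) = (z/A) = omega^((A^2 - 1)/3), because z is a constant times omega * sqrt(-3) modulo A
   and sqrt(-3) does not contribute; this contradicts the hypothesis on A^2 modulo 9.

   Reciprocity is needed only between a primary Eisenstein integer and a rational prime q. It
   follows from the relation g^3 = p * J between Gauss and Jacobi sums modulo p, by computing
   g^(q^2) modulo q with the Frobenius map. The Gauss sum lives in the group ring of the integers
   modulo p, that is, in the polynomials over the Eisenstein integers modulo x^p - 1. *)

theory Submission
  imports Defs "HOL-Computational_Algebra.Polynomial"
begin

section \<open>Eisenstein integers\<close>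

text \<open>\<open>Eis a b\<close> stands for \<open>a + b * \<omega>\<close> with \<open>\<omega>\<^sup>2 + \<omega> + 1 = 0\<close>.\<close>

datatype eis = Eis (fst_eis: int) (snd_eis: int)

lemma eis_eq_iff: "x = y \<longleftrightarrow> fst_eis x = fst_eis y \<and> snd_eis x = snd_eis y"
  by (cases x; cases y) simp

instantiation eis :: comm_ring_1
begin

definition "0 = Eis 0 0"
definition "1 = Eis 1 0"
definition "x + y = Eis (fst_eis x + fst_eis y) (snd_eis x + snd_eis y)"
definition "- x = Eis (- fst_eis x) (- snd_eis x)"
definition "x - y = Eis (fst_eis x - fst_eis y) (snd_eis x - snd_eis y)"
definition "x * y = Eis (fst_eis x * fst_eis y - snd_eis x * snd_eis y)
  (fst_eis x * snd_eis y + snd_eis x * fst_eis y - snd_eis x * snd_eis y)"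

instance
  by standard (simp_all add: eis_eq_iff zero_eis_def one_eis_def plus_eis_def uminus_eis_def
      minus_eis_def times_eis_def algebra_simps)

end

lemma eis_sel_simps [simp]:
  "fst_eis 0 = 0" "snd_eis 0 = 0" "fst_eis 1 = 1" "snd_eis 1 = 0"
  "fst_eis (x + y) = fst_eis x + fst_eis y" "snd_eis (x + y) = snd_eis x + snd_eis y"
  "fst_eis (- x) = - fst_eis x" "snd_eis (- x) = - snd_eis x"
  "fst_eis (x - y) = fst_eis x - fst_eis y" "snd_eis (x - y) = snd_eis x - snd_eis y"
  "fst_eis (x * y) = fst_eis x * fst_eis y - snd_eis x * snd_eis y"
  "snd_eis (x * y) = fst_eis x * snd_eis y + snd_eis x * fst_eis y - snd_eis x * snd_eis y"
  by (simp_all add: zero_eis_def one_eis_def plus_eis_def uminus_eis_def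
      minus_eis_def times_eis_def)

lemma eis_of_int_sel [simp]: "fst_eis (of_int n) = n" "snd_eis (of_int n) = 0"
proof -
  have nat: "fst_eis (of_nat k) = int k \<and> snd_eis (of_nat k) = 0" for k
    by (induction k) auto
  have "fst_eis (of_int n) = n \<and> snd_eis (of_int n) = 0"
    using nat by (cases n rule: int_cases2) auto
  then show "fst_eis (of_int n) = n" "snd_eis (of_int n) = 0"
    by auto
qed

lemma eis_of_nat_sel [simp]: "fst_eis (of_nat n) = int n" "snd_eis (of_nat n) = 0"
  by (induction n) auto

lemma eis_numeral_sel [simp]: "fst_eis (numeral n) = numeral n" "snd_eis (numeral n) = 0"
  using eis_of_int_sel[of "numeral n"] by auto

section \<open>Norm and conjugation\<close>

definition eis_norm :: "eis \<Rightarrow> int" where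
  "eis_norm z = (fst_eis z)\<^sup>2 - fst_eis z * snd_eis z + (snd_eis z)\<^sup>2"

text \<open>The conjugate of \<open>\<omega>\<close> is \<open>-1 - \<omega>\<close>, whence these
  coordinates.\<close>

definition eis_cnj :: "eis \<Rightarrow> eis" where
  "eis_cnj z = Eis (fst_eis z - snd_eis z) (- snd_eis z)"

lemma eis_cnj_sel [simp]: "fst_eis (eis_cnj z) = fst_eis z - snd_eis z"
  "snd_eis (eis_cnj z) = - snd_eis z"
  by (simp_all add: eis_cnj_def)

lemma eis_cnj_simps [simp]: "eis_cnj 0 = 0" "eis_cnj 1 = 1" "eis_cnj (x + y) = eis_cnj x + eis_cnj y"
  "eis_cnj (x * y) = eis_cnj x * eis_cnj y" "eis_cnj (eis_cnj x) = x" "eis_cnj (of_nat n) = of_nat n"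
  by (simp_all add: eis_eq_iff algebra_simps)

lemma eis_cnj_sum: "eis_cnj (\<Sum>i\<in>I. f i) = (\<Sum>i\<in>I. eis_cnj (f i))"
  by (induction I rule: infinite_finite_induct) simp_all

lemma eis_mult_cnj: "z * eis_cnj z = of_int (eis_norm z)"
  by (simp add: eis_eq_iff eis_norm_def power2_eq_square algebra_simps)

lemma eis_norm_mult: "eis_norm (x * y) = eis_norm x * eis_norm y"
  by (simp add: eis_norm_def power2_eq_square algebra_simps)

text \<open>Completing the square exhibits the norm as positive definite and bounds the second
  coordinate of an element of given norm.\<close>

lemma four_eis_norm: "4 * eis_norm z = (2 * fst_eis z - snd_eis z)\<^sup>2 + 3 * (snd_eis z)\<^sup>2"
  by (simp add: eis_norm_def power2_eq_square algebra_simps)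

lemma eis_norm_nonneg: "eis_norm z \<ge> 0"
  using four_eis_norm[of z] by (smt (verit) zero_le_power2)

lemma eis_norm_eq_0_iff [simp]: "eis_norm z = 0 \<longleftrightarrow> z = 0"
proof
  assume "eis_norm z = 0"
  then have "(2 * fst_eis z - snd_eis z)\<^sup>2 + 3 * (snd_eis z)\<^sup>2 = 0"
    using four_eis_norm[of z] by simp
  then have "snd_eis z = 0 \<and> 2 * fst_eis z - snd_eis z = 0"
    by (smt (verit) zero_le_power2 zero_eq_power2)
  then show "z = 0" by (simp add: eis_eq_iff)
qed (simp add: eis_norm_def)

instance eis :: idom
proof
  fix x y :: eis
  assume "x \<noteq> 0" "y \<noteq> 0"
  then have "eis_norm (x * y) \<noteq> 0"
    by (simp only: eis_norm_mult mult_eq_0_iff eis_norm_eq_0_iff) simp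
  then show "x * y \<noteq> 0" by auto
qed

instance eis :: ring_char_0
proof
  show "inj (of_nat :: nat \<Rightarrow> eis)"
    by (rule injI) (metis eis_of_nat_sel(1) of_nat_eq_iff)
qed

lemma of_int_dvd_eis_iff: "of_int n dvd z \<longleftrightarrow> n dvd fst_eis z \<and> n dvd snd_eis z"
proof
  assume "of_int n dvd z"
  then show "n dvd fst_eis z \<and> n dvd snd_eis z" by (auto elim!: dvdE)
next
  assume "n dvd fst_eis z \<and> n dvd snd_eis z"
  then obtain a b where "fst_eis z = n * a" "snd_eis z = n * b" by (auto elim!: dvdE)
  then have "z = of_int n * Eis a b" by (simp add: eis_eq_iff)
  then show "of_int n dvd z" by simp
qed

lemma of_nat_dvd_eis_iff: "of_nat n dvd z \<longleftrightarrow> int n dvd fst_eis z \<and> int n dvd snd_eis z"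
  using of_int_dvd_eis_iff[of "int n" z] by simp

section \<open>Cube roots of unity\<close>

definition eis_omega :: eis ("\<omega>") where "\<omega> = Eis 0 1"

lemma omega_sel [simp]: "fst_eis \<omega> = 0" "snd_eis \<omega> = 1"
  by (simp_all add: eis_omega_def)

lemma omega_power3 [simp]: "\<omega> ^ 3 = 1"
  by (simp add: eis_eq_iff eval_nat_numeral)

lemma omega_power_mod3: "\<omega> ^ n = \<omega> ^ (n mod 3)"
proof -
  have "\<omega> ^ n = (\<omega> ^ 3) ^ (n div 3) * \<omega> ^ (n mod 3)"
    by (simp only: power_mult [symmetric] power_add [symmetric] mult_div_mod_eq)
  then show ?thesis by simp
qed

definition eis_mu3 :: "eis set" where "eis_mu3 = {1, \<omega>, \<omega>\<^sup>2}"

lemma eis_mu3_mult: "x \<in> eis_mu3 \<Longrightarrow> y \<in> eis_mu3 \<Longrightarrow> x * y \<in> eis_mu3"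
  by (auto simp: eis_mu3_def eis_eq_iff power2_eq_square)

lemma eis_mu3_power3: "x \<in> eis_mu3 \<Longrightarrow> x ^ 3 = 1"
  by (auto simp: eis_mu3_def eis_eq_iff eval_nat_numeral)

lemma eis_mu3_cnj: "x \<in> eis_mu3 \<Longrightarrow> eis_cnj x = x\<^sup>2"
  by (auto simp: eis_mu3_def eis_eq_iff power2_eq_square)

lemma omega_power_mu3: "\<omega> ^ n \<in> eis_mu3"
proof -
  have "n mod 3 = 0 \<or> n mod 3 = 1 \<or> n mod 3 = 2" by linarith
  then show ?thesis
    using omega_power_mod3[of n] by (auto simp: eis_mu3_def)
qed

lemma omega_power_eq_1_iff: "\<omega> ^ n = 1 \<longleftrightarrow> 3 dvd n"
proof -
  have "n mod 3 = 0 \<or> n mod 3 = 1 \<or> n mod 3 = 2" by linarith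
  then show ?thesis
    using omega_power_mod3[of n] by (auto simp: eis_eq_iff power2_eq_square dvd_eq_mod_eq_0)
qed

text \<open>The difference of two distinct cube roots of unity has a coordinate 1 or -1, so no
  rational prime divides it. This turns congruences between symbol values into equalities.\<close>

lemma eis_mu3_eqI:
  assumes "x \<in> eis_mu3" "y \<in> eis_mu3" "of_nat q dvd x - y" "prime q"
  shows "x = y"
proof -
  have "\<not> int q dvd 1" "\<not> int q dvd - 1"
    using prime_gt_1_nat[OF assms(4)] by auto
  then show ?thesis
    using assms(1-3) by (auto simp: eis_mu3_def of_nat_dvd_eis_iff power2_eq_square)
qed

section \<open>Frobenius congruences modulo a rational prime\<close>

lemma freshmans_dream_dvd:
  fixes x y :: "'a :: comm_ring_1"
  assumes "prime q"
  shows "of_nat q dvd (x + y) ^ q - (x ^ q + y ^ q)"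
proof -
  have q: "q > 1" using assms prime_gt_1_nat by blast
  have "(x + y) ^ q = (\<Sum>k\<le>q. of_nat (q choose k) * x ^ k * y ^ (q - k))"
    by (rule binomial_ring)
  also have "{..q} = insert 0 (insert q {1..<q})" using q by auto
  also have "(\<Sum>k\<in>\<dots>. of_nat (q choose k) * x ^ k * y ^ (q - k)) =
      y ^ q + (x ^ q + (\<Sum>k=1..<q. of_nat (q choose k) * x ^ k * y ^ (q - k)))"
    using q by (subst sum.insert; simp)+
  finally have "(x + y) ^ q - (x ^ q + y ^ q) = (\<Sum>k=1..<q. of_nat (q choose k) * x ^ k * y ^ (q - k))"
    by (simp add: algebra_simps)
  also have "of_nat q dvd \<dots>"
  proof (rule dvd_sum)
    fix k assume "k \<in> {1..<q}"
    then have "q dvd (q choose k)" using assms by (intro dvd_choose_prime) auto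
    then obtain t where "q choose k = q * t" by (elim dvdE)
    then show "of_nat q dvd of_nat (q choose k) * x ^ k * y ^ (q - k)"
      by (simp add: mult.assoc)
  qed
  finally show ?thesis .
qed

lemma freshmans_dream_sum_dvd:
  fixes f :: "'b \<Rightarrow> 'a :: comm_ring_1"
  assumes "prime q"
  shows "of_nat q dvd (\<Sum>i\<in>I. f i) ^ q - (\<Sum>i\<in>I. f i ^ q)"
proof (induction I rule: infinite_finite_induct)
  case (insert i I)
  have "(\<Sum>i\<in>insert i I. f i) ^ q - (\<Sum>i\<in>insert i I. f i ^ q) =
      ((f i + sum f I) ^ q - (f i ^ q + sum f I ^ q)) + (sum f I ^ q - (\<Sum>i\<in>I. f i ^ q))"
    using insert by (simp add: algebra_simps)
  then show ?case
    by (simp only:) (intro dvd_add freshmans_dream_dvd assms insert.IH)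
qed (use assms prime_gt_0_nat in \<open>auto simp: zero_power\<close>)

lemma dvd_power_diff:
  fixes a b d :: "'a :: comm_ring_1"
  assumes "d dvd a - b"
  shows "d dvd a ^ n - b ^ n"
  using assms by (simp add: power_diff_sumr2)

section \<open>Cubic residue characters and Jacobi sums\<close>

lemma not_dvd_three:
  assumes "prime (p::nat)" "p \<noteq> 3"
  shows "\<not> int p dvd 3"
proof
  assume "int p dvd 3"
  then have "int p dvd int 3" by simp
  then have "p dvd 3" by (simp only: of_nat_dvd_iff)
  then show False using assms primes_dvd_imp_eq[of p 3] by simp
qed

text \<open>The division by 3 in the exponent (q^2 - 1)/3 is exact for every q prime to 3, so the
  classes 1 and 2 modulo 3 are treated alike.\<close>

lemma three_dvd_square_minus_1:
  assumes "\<not> 3 dvd (q :: nat)"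
  shows "3 * ((q\<^sup>2 - 1) div 3) + 1 = q\<^sup>2"
proof -
  have "q mod 3 = 1 \<or> q mod 3 = 2" using assms by (auto simp: dvd_eq_mod_eq_0)
  then have "q\<^sup>2 mod 3 = 1"
    by (auto simp: power2_eq_square mod_mult_eq[of q 3 q, symmetric])
  then show ?thesis by presburger
qed

lemma fermat_int:
  assumes "prime q" "\<not> int q dvd a"
  shows "[a ^ ((q - 1) * k) = 1] (mod int q)"
proof -
  define s where "s = nat (a mod int q)"
  have s: "[int s = a] (mod int q)"
    using prime_gt_0_nat[OF assms(1)] by (simp add: s_def cong_def)
  then have "\<not> q dvd s"
    using assms(2) by (metis cong_0_iff cong_sym cong_trans int_dvd_int_iff)
  then have "[s ^ (q - 1) = 1] (mod q)" using fermat_theorem assms(1) by blast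
  then have "[int s ^ (q - 1) = 1] (mod int q)"
    using cong_int_iff[of "s ^ (q - 1)" 1 q] by simp
  then have "[a ^ (q - 1) = 1] (mod int q)" using s cong_pow cong_trans cong_sym by blast
  then have "[(a ^ (q - 1)) ^ k = 1 ^ k] (mod int q)" by (rule cong_pow)
  then show ?thesis by (simp add: power_mult)
qed

text \<open>Since p is not 3, r is a primitive cube root of unity modulo p. Choosing r chooses one
  of the two Eisenstein primes above p; that p is 1 modulo 3 is then derived in
  \<open>three_third\<close>.\<close>

locale cubic_residue_symbol =
  fixes p :: nat and r :: int
  assumes prime_p: "prime p" and p_neq_3: "p \<noteq> 3" and root: "int p dvd r\<^sup>2 + r + 1"
begin

lemma prime_int_p: "prime (int p)"
  using prime_p by simp

lemma p_gt_1: "p > 1"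
  using prime_p prime_gt_1_nat by blast

lemma p_not_dvd_3: "\<not> int p dvd 3"
  using not_dvd_three prime_p p_neq_3 by blast

text \<open>Up to sign these are the differences of 1, r and -1 - r, the images of the three cube
  roots of unity. Modulo r^2 + r + 1, both (r - 1)(r + 2) and (2r + 1)^2 are -3, while p does not
  divide 3.\<close>

lemma differences_not_dvd:
  "\<not> int p dvd r - 1" "\<not> int p dvd r + 2" "\<not> int p dvd 2 * r + 1"
proof -
  have "int p dvd 3" if "int p dvd (r - 1) * (r + 2)"
  proof -
    have "int p dvd (r\<^sup>2 + r + 1) - (r - 1) * (r + 2)" using root that by (rule dvd_diff)
    also have "(r\<^sup>2 + r + 1) - (r - 1) * (r + 2) = 3" by (simp add: algebra_simps power2_eq_square)
    finally show ?thesis .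
  qed
  then show "\<not> int p dvd r - 1" "\<not> int p dvd r + 2"
    using p_not_dvd_3 by (meson dvd_mult dvd_mult2)+
  show "\<not> int p dvd 2 * r + 1"
  proof
    assume "int p dvd 2 * r + 1"
    then have "int p dvd 4 * (r\<^sup>2 + r + 1) - (2 * r + 1) * (2 * r + 1)"
      using root by (intro dvd_diff dvd_mult)
    also have "4 * (r\<^sup>2 + r + 1) - (2 * r + 1) * (2 * r + 1) = 3"
      by (simp add: algebra_simps power2_eq_square)
    finally show False using p_not_dvd_3 by simp
  qed
qed

definition third :: nat where "third = (p - 1) div 3"

text \<open>The order of r modulo p is exactly 3, and it divides p - 1.\<close>

lemma three_third: "3 * third = p - 1"
proof -
  define s where "s = nat (r mod int p)"
  have s: "[int s = r] (mod int p)"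
    using p_gt_1 by (simp add: s_def cong_def)
  have "int p dvd (r - 1) * (r\<^sup>2 + r + 1)" using root by simp
  also have "(r - 1) * (r\<^sup>2 + r + 1) = r ^ 3 - 1"
    by (simp add: algebra_simps power2_eq_square power3_eq_cube)
  finally have "[r ^ 3 = 1] (mod int p)" by (simp add: cong_iff_dvd_diff)
  then have "[int s ^ 3 = 1] (mod int p)" using s cong_pow cong_trans by blast
  then have s3: "[s ^ 3 = 1] (mod p)"
    using cong_int_iff[of "s ^ 3" 1 p] by simp
  then have "ord p s dvd 3" by (simp only: ord_divides)
  then have ord_cases: "ord p s = 1 \<or> ord p s = 3"
    using prime_nat_iff[of 3] by auto
  have "ord p s \<noteq> 1"
  proof
    assume "ord p s = 1"
    then have "[s = 1] (mod p)" using ord[of s p] by simp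
    then have "[int s = 1] (mod int p)" using cong_int_iff[of s 1 p] by simp
    then have "[r = 1] (mod int p)" using s cong_trans cong_sym by blast
    then show False using differences_not_dvd(1) by (simp add: cong_iff_dvd_diff)
  qed
  moreover have "coprime p s"
    using ord_cases ord_eq_0[of p s] by auto
  ultimately have "3 dvd p - 1"
    using ord_cases order_divides_totient[of p s] totient_prime[OF prime_p] by auto
  then show ?thesis by (simp add: third_def)
qed

lemma third_pos: "third > 0"
  using three_third p_gt_1 by (cases third) auto

text \<open>The homomorphism to the integers modulo \<open>p\<close> that sends \<open>\<omega>\<close> to \<open>r\<close>.\<close>

definition reduce :: "eis \<Rightarrow> int" where
  "reduce z = fst_eis z + r * snd_eis z"

lemma reduce_simps [simp]:
  "reduce 0 = 0" "reduce 1 = 1" "reduce (x + y) = reduce x + reduce y"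
  "reduce (x - y) = reduce x - reduce y"
  by (simp_all add: reduce_def algebra_simps)

lemma reduce_sum: "reduce (\<Sum>i\<in>I. f i) = (\<Sum>i\<in>I. reduce (f i))"
  by (induction I rule: infinite_finite_induct) simp_all

lemma reduce_mult: "[reduce (x * y) = reduce x * reduce y] (mod int p)"
proof -
  have "reduce (x * y) - reduce x * reduce y = - (snd_eis x * snd_eis y) * (r\<^sup>2 + r + 1)"
    by (simp add: reduce_def algebra_simps power2_eq_square)
  then show ?thesis using root by (simp add: cong_iff_dvd_diff)
qed

lemma reduce_inj_mu3:
  assumes "u \<in> eis_mu3" "v \<in> eis_mu3" "[reduce u = reduce v] (mod int p)"
  shows "u = v"
proof -
  have "\<not> int p dvd 1 - r" "\<not> int p dvd 1 - (- 1 - r)" "\<not> int p dvd - 1 - r - 1"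
    "\<not> int p dvd r - (- 1 - r)" "\<not> int p dvd - 1 - r - r"
    using differences_not_dvd dvd_minus_iff[of "int p" "r - 1"]
      dvd_minus_iff[of "int p" "r + 2"] dvd_minus_iff[of "int p" "2 * r + 1"]
    by (simp_all add: algebra_simps)
  then show ?thesis
    using assms differences_not_dvd(1)
    by (auto simp: eis_mu3_def reduce_def cong_iff_dvd_diff power2_eq_square)
qed

lemma cube_root_of_unity:
  assumes "[x ^ 3 = 1] (mod int p)"
  obtains u where "u \<in> eis_mu3" "[reduce u = x] (mod int p)"
proof -
  \<comment> \<open>Modulo r^2 + r + 1 the polynomial x^3 - 1 splits as (x - 1)(x - r)(x - r^2); the
    subtracted multiple is the discrepancy.\<close>
  have "int p dvd (x ^ 3 - 1) - (r\<^sup>2 + r + 1) * (x\<^sup>2 - r * x + (r - 1))"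
    using assms root by (intro dvd_diff[OF _ dvd_mult2]) (simp_all add: cong_iff_dvd_diff)
  also have "(x ^ 3 - 1) - (r\<^sup>2 + r + 1) * (x\<^sup>2 - r * x + (r - 1)) = (1 - x) * ((r - x) * (x - r\<^sup>2))"
    by (simp add: algebra_simps power2_eq_square power3_eq_cube)
  finally have "int p dvd 1 - x \<or> int p dvd r - x \<or> int p dvd x - r\<^sup>2"
    using prime_int_p by (simp add: prime_dvd_mult_iff)
  moreover have "[reduce (\<omega>\<^sup>2) = x] (mod int p)" if "int p dvd x - r\<^sup>2"
  proof -
    have "int p dvd - (x - r\<^sup>2) - (r\<^sup>2 + r + 1)"
      using that root by (intro dvd_diff) (simp_all only: dvd_minus_iff)
    then show ?thesis
      by (simp add: reduce_def power2_eq_square cong_iff_dvd_diff algebra_simps)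
  qed
  moreover have "[reduce 1 = x] (mod int p)" if "int p dvd 1 - x"
    using that by (simp add: cong_iff_dvd_diff)
  moreover have "[reduce \<omega> = x] (mod int p)" if "int p dvd r - x"
    using that by (simp add: cong_iff_dvd_diff reduce_def)
  ultimately show ?thesis
    using that unfolding eis_mu3_def by blast
qed

text \<open>The power residue a^((p - 1)/3) is lifted to a genuine cube root of unity. The choice is
  possible by \<open>cube_root_of_unity\<close> and unique by \<open>reduce_inj_mu3\<close>.\<close>

definition \<chi> :: "int \<Rightarrow> eis" where
  "\<chi> a = (if int p dvd a then 0 else SOME u. u \<in> eis_mu3 \<and> [reduce u = a ^ third] (mod int p))"

lemma chi_eq_0: "int p dvd a \<Longrightarrow> \<chi> a = 0"
  by (simp add: \<chi>_def)

lemma chi_aux: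
  assumes "\<not> int p dvd a"
  shows "\<chi> a \<in> eis_mu3 \<and> [reduce (\<chi> a) = a ^ third] (mod int p)"
proof -
  have "[(a ^ third) ^ 3 = 1] (mod int p)"
    using fermat_int[OF prime_p assms, of 1] by (simp only: power_mult [symmetric] mult.commute[of third] three_third mult_1_right)
  then have "\<exists>u. u \<in> eis_mu3 \<and> [reduce u = a ^ third] (mod int p)"
    using cube_root_of_unity by metis
  then show ?thesis
    using assms unfolding \<chi>_def by (simp only: if_False) (rule someI_ex)
qed

lemma chi_mu3: "\<not> int p dvd a \<Longrightarrow> \<chi> a \<in> eis_mu3"
  using chi_aux by blast

lemma reduce_chi: "[reduce (\<chi> a) = a ^ third] (mod int p)"
proof (cases "int p dvd a")
  case True
  then have "[a ^ third = 0] (mod int p)"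
    using third_pos by (metis cong_0_iff dvd_power dvd_trans)
  then show ?thesis using True by (simp add: chi_eq_0 cong_sym)
qed (use chi_aux in blast)

lemma chi_eqI:
  assumes "\<not> int p dvd a" "u \<in> eis_mu3" "[reduce u = a ^ third] (mod int p)"
  shows "\<chi> a = u"
  using assms chi_aux reduce_inj_mu3 cong_trans cong_sym by blast

lemma chi_mult: "\<chi> (a * b) = \<chi> a * \<chi> b"
proof (cases "int p dvd a * b")
  case True
  then have "int p dvd a \<or> int p dvd b" using prime_int_p by (simp add: prime_dvd_mult_iff)
  then show ?thesis using True by (auto simp: chi_eq_0)
next
  case False
  then have "\<not> int p dvd a" "\<not> int p dvd b" by auto
  then have "\<chi> a * \<chi> b \<in> eis_mu3" by (simp add: chi_mu3 eis_mu3_mult)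
  moreover have "[reduce (\<chi> a * \<chi> b) = (a * b) ^ third] (mod int p)"
    unfolding power_mult_distrib
    using reduce_mult cong_mult[OF reduce_chi reduce_chi] cong_trans by blast
  ultimately show ?thesis using False chi_eqI by blast
qed

lemma chi_cong:
  assumes "[a = b] (mod int p)"
  shows "\<chi> a = \<chi> b"
proof (cases "int p dvd a")
  case True
  then have "int p dvd b" using assms cong_dvd_iff[OF assms]
    by (metis cong_0_iff cong_sym cong_trans)
  then show ?thesis using True by (simp add: chi_eq_0)
next
  case False
  then have b: "\<not> int p dvd b" using assms by (metis cong_0_iff cong_trans)
  show ?thesis
    by (rule chi_eqI[OF False chi_mu3[OF b]])
      (meson reduce_chi assms cong_pow cong_trans cong_sym)
qed

lemma chi_mod [simp]: "\<chi> (a mod int p) = \<chi> a"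
  by (rule chi_cong) (simp add: cong_def)

lemma chi_cube:
  assumes "\<not> int p dvd a"
  shows "\<chi> (a ^ 3) = 1"
proof -
  have "\<chi> (a ^ 3) = \<chi> a ^ 3" by (simp add: power3_eq_cube chi_mult)
  then show ?thesis using assms chi_mu3 eis_mu3_power3 by metis
qed

lemma p_neq_Suc_0 [simp]: "p \<noteq> Suc 0"
  using p_gt_1 by simp

lemma chi_1 [simp]: "\<chi> 1 = 1"
  using chi_cube[of 1] by simp

lemma chi_uminus [simp]: "\<chi> (- a) = \<chi> a"
proof -
  have "\<chi> (- 1) = 1" using chi_cube[of "- 1"] p_gt_1 by (simp add: power3_eq_cube)
  then show ?thesis using chi_mult[of "- 1" a] by simp
qed

lemma chi_cnj: "eis_cnj (\<chi> a) = \<chi> a * \<chi> a"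
proof (cases "int p dvd a")
  case False
  then show ?thesis using chi_mu3 eis_mu3_cnj by (simp add: power2_eq_square)
qed (simp add: chi_eq_0)

lemma chi_mult_cnj: "\<chi> a * eis_cnj (\<chi> a) = (if int p dvd a then 0 else 1)"
proof (cases "int p dvd a")
  case False
  then have "\<chi> a ^ 3 = 1" using chi_mu3 eis_mu3_power3 by blast
  then show ?thesis using False by (simp add: chi_cnj power3_eq_cube mult.assoc)
qed (simp add: chi_eq_0)

section \<open>Sums over complete residue systems\<close>

abbreviation Zp :: "int set" where "Zp \<equiv> {0..<int p}"

lemma bij_betw_affine:
  assumes "\<not> int p dvd u"
  shows "bij_betw (\<lambda>a. (u * a + t) mod int p) Zp Zp"
proof -
  have inj: "inj_on (\<lambda>a. (u * a + t) mod int p) Zp"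
  proof (rule inj_onI)
    fix a b assume ab: "a \<in> Zp" "b \<in> Zp" "(u * a + t) mod int p = (u * b + t) mod int p"
    then have "int p dvd (u * a + t) - (u * b + t)" by (simp add: mod_eq_dvd_iff)
    also have "(u * a + t) - (u * b + t) = u * (a - b)" by (simp add: algebra_simps)
    finally have "int p dvd a - b"
      using assms prime_int_p by (simp add: prime_dvd_mult_iff)
    then have "a mod int p = b mod int p" by (simp add: mod_eq_dvd_iff)
    then show "a = b" using ab by simp
  qed
  moreover have "(\<lambda>a. (u * a + t) mod int p) ` Zp \<subseteq> Zp"
    using p_gt_1 by auto
  ultimately show ?thesis
    unfolding bij_betw_def using endo_inj_surj[of Zp] by blast
qed

lemma sum_Zp_affine:
  assumes "\<And>a. F (a mod int p) = F a" "\<not> int p dvd u"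
  shows "(\<Sum>a\<in>Zp. F (u * a + t)) = (\<Sum>a\<in>Zp. F a)"
proof -
  have "(\<Sum>a\<in>Zp. F (u * a + t)) = (\<Sum>a\<in>Zp. F ((u * a + t) mod int p))"
    by (simp add: assms(1))
  also have "\<dots> = (\<Sum>a\<in>Zp. F a)"
    by (rule sum.reindex_bij_betw[OF bij_betw_affine[OF assms(2)]])
  finally show ?thesis .
qed

lemma sum_Zp_delta_int:
  "(\<Sum>a\<in>Zp. if int p dvd a then x else y) = x + of_nat (p - 1) * (y :: 'a :: comm_ring_1)"
proof -
  have eq: "Zp = insert 0 {1..<int p}" using p_gt_1 by auto
  have "(\<Sum>a\<in>{1..<int p}. if int p dvd a then x else y) = (\<Sum>a\<in>{1..<int p}. y)"
    by (rule sum.cong) (auto dest!: zdvd_imp_le)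
  also have "\<dots> = of_nat (card {1..<int p}) * y"
    by simp
  also have "card {1..<int p} = p - 1"
    using p_gt_1 by simp
  finally show ?thesis unfolding eq by simp
qed

lemma primitive_root:
  obtains g where "\<not> int p dvd g" "\<And>k. 0 < k \<Longrightarrow> k < p - 1 \<Longrightarrow> \<not> [g ^ k = 1] (mod int p)"
proof -
  obtain g where ord: "ord p g = p - 1"
    using residue_prime_has_primroot[OF prime_p] by blast
  \<comment> \<open>The library order is 0 on non-units, so the value p - 1 > 0 forces
    coprimality.\<close>
  then have "coprime p g" using p_gt_1 by (metis ord_eq_0 zero_less_diff less_irrefl)
  then have "\<not> int p dvd int g"
    using p_gt_1 by (auto simp: coprime_absorb_left)
  moreover have "\<not> [int g ^ k = 1] (mod int p)" if k: "0 < k" "k < p - 1" for k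
  proof
    assume "[int g ^ k = 1] (mod int p)"
    then have "[g ^ k = 1] (mod p)" using cong_int_iff[of "g ^ k" 1 p] by simp
    then have "ord p g dvd k" by (simp only: ord_divides)
    then show False using k ord by (auto dest: dvd_imp_le)
  qed
  ultimately show ?thesis using that by blast
qed

text \<open>Multiplying all residues by a primitive root g permutes them and scales the sum by g^k,
  which is not 1 modulo p.\<close>

lemma sum_powers_dvd:
  assumes "0 < k" "k < p - 1"
  shows "int p dvd (\<Sum>a\<in>Zp. a ^ k)"
proof -
  obtain g where g: "\<not> int p dvd g" "\<not> [g ^ k = 1] (mod int p)"
    using primitive_root assms by blast
  define S where "S = (\<Sum>a\<in>Zp. a ^ k)"
  have "[g ^ k * S = (\<Sum>a\<in>Zp. (g * a) ^ k mod int p)] (mod int p)"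
    by (simp add: S_def sum_distrib_left power_mult_distrib cong_def mod_sum_eq)
  also have "(\<Sum>a\<in>Zp. (g * a) ^ k mod int p) = (\<Sum>a\<in>Zp. a ^ k mod int p)"
    using sum_Zp_affine[of "\<lambda>a. a ^ k mod int p" g 0] g by (simp add: power_mod)
  also have "[\<dots> = S] (mod int p)"
    by (simp add: S_def cong_def mod_sum_eq)
  finally have "int p dvd (g ^ k - 1) * S"
    by (simp add: cong_iff_dvd_diff algebra_simps)
  moreover have "\<not> int p dvd g ^ k - 1" using g by (simp add: cong_iff_dvd_diff)
  ultimately show ?thesis using prime_int_p unfolding S_def by (simp add: prime_dvd_mult_iff)
qed

text \<open>The same scaling argument: a primitive root has a cubic character different from 1
  because 0 < (p - 1)/3 < p - 1.\<close>

lemma sum_chi: "(\<Sum>a\<in>Zp. \<chi> a) = 0"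
proof -
  obtain g where g: "\<not> int p dvd g" "\<not> [g ^ third = 1] (mod int p)"
  proof (rule primitive_root)
    fix g assume g: "\<not> int p dvd g" "\<And>k. 0 < k \<Longrightarrow> k < p - 1 \<Longrightarrow> \<not> [g ^ k = 1] (mod int p)"
    then show thesis using that[of g] g(2)[of third] third_pos three_third by linarith
  qed
  have "\<chi> g \<noteq> 1"
    using reduce_chi[of g] g by (metis cong_sym reduce_simps(2))
  have "\<chi> g * (\<Sum>a\<in>Zp. \<chi> a) = (\<Sum>a\<in>Zp. \<chi> (g * a + 0))"
    by (simp add: sum_distrib_left chi_mult)
  also have "\<dots> = (\<Sum>a\<in>Zp. \<chi> a)"
    by (rule sum_Zp_affine) (use g in auto)
  finally show ?thesis using \<open>\<chi> g \<noteq> 1\<close> by simp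
qed

lemma sum_chi_shift: "(\<Sum>a\<in>Zp. \<chi> (a - c)) = 0"
  using sum_Zp_affine[of \<chi> 1 "- c"] sum_chi by simp

section \<open>The Jacobi sum and convolutions of characters\<close>

definition J :: eis where "J = (\<Sum>a\<in>Zp. \<chi> a * \<chi> (1 - a))"

text \<open>Modulo p the summands become a^t (1 - a)^t with t = (p - 1)/3, a polynomial whose
  monomials have degrees from t to 2t, strictly between 0 and p - 1, so that every power sum
  vanishes. Hence J lies in the prime above p selected by r.\<close>

lemma reduce_J: "int p dvd reduce J"
proof -
  have "[reduce J = (\<Sum>a\<in>Zp. a ^ third * (1 - a) ^ third)] (mod int p)"
    unfolding J_def reduce_sum
  proof (rule cong_sum)
    fix a
    show "[reduce (\<chi> a * \<chi> (1 - a)) = a ^ third * (1 - a) ^ third] (mod int p)"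
      using reduce_mult cong_mult[OF reduce_chi reduce_chi] cong_trans by blast
  qed
  also have "(\<Sum>a\<in>Zp. a ^ third * (1 - a) ^ third) =
      (\<Sum>a\<in>Zp. \<Sum>k\<le>third. (of_nat (third choose k) * (- 1) ^ k) * a ^ (third + k))"
  proof (rule sum.cong[OF refl])
    fix a :: int
    have "(1 - a) ^ third = (- a + 1) ^ third" by simp
    also have "\<dots> = (\<Sum>k\<le>third. of_nat (third choose k) * (- a) ^ k * 1 ^ (third - k))"
      by (rule binomial_ring)
    finally show "a ^ third * (1 - a) ^ third =
        (\<Sum>k\<le>third. (of_nat (third choose k) * (- 1) ^ k) * a ^ (third + k))"
      by (simp add: sum_distrib_left power_add power_minus[of a] mult_ac)
  qed
  also have "\<dots> = (\<Sum>k\<le>third. (of_nat (third choose k) * (- 1) ^ k) * (\<Sum>a\<in>Zp. a ^ (third + k)))"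
    by (subst sum.swap) (simp add: sum_distrib_left)
  also have "[\<dots> = 0] (mod int p)"
    unfolding cong_0_iff
  proof (rule dvd_sum)
    fix k assume "k \<in> {..third}"
    then have "0 < third + k" "third + k < p - 1"
      using three_third third_pos by auto
    then show "int p dvd (of_nat (third choose k) * (- 1) ^ k) * (\<Sum>a\<in>Zp. a ^ (third + k))"
      by (intro dvd_mult sum_powers_dvd)
  qed
  finally show ?thesis by (simp add: cong_0_iff)
qed

text \<open>Substituting c a for a pulls out the square of \<chi> c, which is its conjugate. If p
  divides c, the summands are the conjugates of \<chi> a, since \<chi> is even, and they add up to
  0.\<close>

lemma conv_chi_chi: "(\<Sum>a\<in>Zp. \<chi> a * \<chi> (c - a)) = J * eis_cnj (\<chi> c)"
proof (cases "int p dvd c")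
  case True
  have "\<chi> (c - a) = \<chi> a" for a
  proof -
    have "\<chi> (c - a) = \<chi> (- a)"
      by (rule chi_cong) (use True in \<open>simp add: cong_iff_dvd_diff\<close>)
    then show ?thesis by simp
  qed
  then have "(\<Sum>a\<in>Zp. \<chi> a * \<chi> (c - a)) = eis_cnj (\<Sum>a\<in>Zp. \<chi> a)"
    by (simp add: chi_cnj eis_cnj_sum)
  then show ?thesis using True by (simp add: sum_chi chi_eq_0)
next
  case False
  have per: "\<chi> (a mod int p) * \<chi> (c - a mod int p) = \<chi> a * \<chi> (c - a)" for a
  proof -
    have "\<chi> (c - a mod int p) = \<chi> (c - a)"
      by (rule chi_cong) (simp add: cong_def mod_diff_right_eq)
    then show ?thesis by simp
  qed
  have "(\<Sum>a\<in>Zp. \<chi> a * \<chi> (c - a)) = (\<Sum>a\<in>Zp. \<chi> (c * a + 0) * \<chi> (c - (c * a + 0)))"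
    by (rule sum_Zp_affine[symmetric]) (use per False in auto)
  also have "\<dots> = (\<Sum>a\<in>Zp. (\<chi> c * \<chi> c) * (\<chi> a * \<chi> (1 - a)))"
  proof (rule sum.cong[OF refl])
    fix a
    have "c - (c * a + 0) = c * (1 - a)" by (simp add: algebra_simps)
    then show "\<chi> (c * a + 0) * \<chi> (c - (c * a + 0)) = (\<chi> c * \<chi> c) * (\<chi> a * \<chi> (1 - a))"
      by (simp only: chi_mult add_0_right) (simp only: mult_ac)
  qed
  finally show ?thesis
    by (simp add: J_def chi_cnj sum_distrib_left mult_ac)
qed

text \<open>The coefficients of \<open>p - T\<close>, where \<open>T\<close> is the sum of all elements of the group.\<close>

definition \<delta> :: "int \<Rightarrow> eis" where "\<delta> c = (if int p dvd c then of_nat p - 1 else - 1)"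

text \<open>These will be the coefficients of the Gauss sum times its conjugate. They have the
  common value \<open>K\<close> at all c prime to p, by substituting c a for a.\<close>

lemma conv_chi_cnj: "(\<Sum>a\<in>Zp. \<chi> a * eis_cnj (\<chi> (c - a))) = \<delta> c"
proof -
  define K where "K = (\<Sum>a\<in>Zp. \<chi> a * eis_cnj (\<chi> (1 - a)))"
  have p1: "of_nat (p - 1) = (of_nat p - 1 :: eis)" using p_gt_1 by (simp add: of_nat_diff)
  have conv: "(\<Sum>a\<in>Zp. \<chi> a * eis_cnj (\<chi> (c - a))) = (if int p dvd c then of_nat (p - 1) else K)" for c
  proof (cases "int p dvd c")
    case True
    have "\<chi> (c - a) = \<chi> a" for a
    proof -
      have "\<chi> (c - a) = \<chi> (- a)"
        by (rule chi_cong) (use True in \<open>simp add: cong_iff_dvd_diff\<close>)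
      then show ?thesis by simp
    qed
    then have "(\<Sum>a\<in>Zp. \<chi> a * eis_cnj (\<chi> (c - a))) = (\<Sum>a\<in>Zp. if int p dvd a then 0 else 1)"
      by (simp only: chi_mult_cnj)
    then show ?thesis using True by (simp only: sum_Zp_delta_int) simp
  next
    case False
    have per: "\<chi> (a mod int p) * eis_cnj (\<chi> (c - a mod int p)) = \<chi> a * eis_cnj (\<chi> (c - a))" for a
    proof -
      have "\<chi> (c - a mod int p) = \<chi> (c - a)"
        by (rule chi_cong) (simp add: cong_def mod_diff_right_eq)
      then show ?thesis by simp
    qed
    have "(\<Sum>a\<in>Zp. \<chi> a * eis_cnj (\<chi> (c - a))) =
        (\<Sum>a\<in>Zp. \<chi> (c * a + 0) * eis_cnj (\<chi> (c - (c * a + 0))))"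
      by (rule sum_Zp_affine[symmetric]) (use per False in auto)
    also have "\<dots> = (\<Sum>a\<in>Zp. (\<chi> c * eis_cnj (\<chi> c)) * (\<chi> a * eis_cnj (\<chi> (1 - a))))"
    proof (rule sum.cong[OF refl])
      fix a
      have "c - (c * a + 0) = c * (1 - a)" by (simp add: algebra_simps)
      then show "\<chi> (c * a + 0) * eis_cnj (\<chi> (c - (c * a + 0))) =
          (\<chi> c * eis_cnj (\<chi> c)) * (\<chi> a * eis_cnj (\<chi> (1 - a)))"
        by (simp only: chi_mult add_0_right eis_cnj_simps) (simp only: mult_ac)
    qed
    also have "\<dots> = K"
      using False by (simp only: chi_mult_cnj if_False mult_1 K_def)
    finally show ?thesis using False by simp
  qed
  \<comment> \<open>The value of \<open>K\<close> follows by summing over all \<open>c\<close>.\<close>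
  have "of_nat (p - 1) + of_nat (p - 1) * K = (\<Sum>c\<in>Zp. \<Sum>a\<in>Zp. \<chi> a * eis_cnj (\<chi> (c - a)))"
    by (simp only: conv sum_Zp_delta_int)
  also have "\<dots> = (\<Sum>a\<in>Zp. \<chi> a * eis_cnj (\<Sum>c\<in>Zp. \<chi> (c - a)))"
    by (subst sum.swap) (simp add: sum_distrib_left eis_cnj_sum)
  also have "\<dots> = 0" by (simp add: sum_chi_shift)
  finally have "of_nat (p - 1) * (1 + K) = 0" by (simp add: distrib_left)
  moreover have "of_nat (p - 1) \<noteq> (0 :: eis)"
    using p_gt_1 by (subst of_nat_eq_0_iff) simp
  ultimately have "K = - 1" by (simp add: add_eq_0_iff)
  then show ?thesis using conv[of c] p1 by (simp add: \<delta>_def)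
qed

text \<open>\<delta> is p times the indicator of 0 minus the constant 1, and the constant
  contributes only a sum of \<chi>, which is 0. So p - T acts on the Gauss sum as p does, though it
  differs from p in the group ring.\<close>

lemma conv_chi_delta: "(\<Sum>a\<in>Zp. \<chi> a * \<delta> (c - a)) = of_nat p * \<chi> c"
proof -
  have eq: "\<chi> a * \<delta> (c - a) = (if a = c mod int p then of_nat p * \<chi> a else 0) - \<chi> a" if "a \<in> Zp" for a
  proof -
    have "int p dvd c - a \<longleftrightarrow> c mod int p = a mod int p" by (simp add: mod_eq_dvd_iff)
    then have "int p dvd c - a \<longleftrightarrow> a = c mod int p" using that by auto
    then show ?thesis by (simp add: \<delta>_def algebra_simps)
  qed
  have "(\<Sum>a\<in>Zp. \<chi> a * \<delta> (c - a)) =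
      (\<Sum>a\<in>Zp. if a = c mod int p then of_nat p * \<chi> a else 0) - (\<Sum>a\<in>Zp. \<chi> a)"
    by (simp add: eq sum_subtractf)
  also have "\<dots> = of_nat p * \<chi> c"
    using p_gt_1 by (simp add: sum_chi)
  finally show ?thesis .
qed

section \<open>Gauss sums in the group ring\<close>

definition cyc :: "eis poly" where "cyc = monom 1 p - 1"

text \<open>Congruence modulo the ideal generated by \<open>q\<close> and \<open>x ^ p - 1\<close>; for \<open>q = 0\<close> this is equality in
  the group ring.\<close>

definition qcong :: "nat \<Rightarrow> eis poly \<Rightarrow> eis poly \<Rightarrow> bool" where
  "qcong q f g \<longleftrightarrow> (\<exists>u v. f - g = of_nat q * u + cyc * v)"

lemma qcongI: "f - g = of_nat q * u + cyc * v \<Longrightarrow> qcong q f g"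
  unfolding qcong_def by blast

lemma qcong_refl [simp]: "qcong q f f"
  by (rule qcongI[of _ _ _ 0 0]) simp

lemma qcong_dvdI: "of_nat q dvd f - g \<Longrightarrow> qcong q f g"
  by (metis add.right_neutral dvdE mult_zero_right qcongI)

lemma qcong_0I: "cyc dvd f - g \<Longrightarrow> qcong 0 f g"
  by (metis add.left_neutral dvdE mult_zero_left of_nat_0 qcongI)

lemma qcong_from_0:
  assumes "qcong 0 f g"
  shows "qcong q f g"
proof -
  obtain v where "f - g = cyc * v" using assms by (auto simp: qcong_def)
  then show ?thesis by (intro qcongI[of _ _ _ 0 v]) simp
qed

lemma qcong_sym:
  assumes "qcong q f g"
  shows "qcong q g f"
proof -
  obtain u v where "f - g = of_nat q * u + cyc * v" using assms by (auto simp: qcong_def)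
  then show ?thesis by (intro qcongI[of _ _ _ "- u" "- v"]) (simp add: algebra_simps)
qed

lemma qcong_add:
  assumes "qcong q f g" "qcong q f' g'"
  shows "qcong q (f + f') (g + g')"
proof -
  obtain u v u' v' where "f - g = of_nat q * u + cyc * v" "f' - g' = of_nat q * u' + cyc * v'"
    using assms by (auto simp: qcong_def)
  then have "(f + f') - (g + g') = of_nat q * (u + u') + cyc * (v + v')"
    by (simp add: algebra_simps)
  then show ?thesis by (rule qcongI)
qed

lemma qcong_trans [trans]:
  assumes "qcong q f g" "qcong q g h"
  shows "qcong q f h"
proof -
  have "qcong q (f + g) (g + h)" using assms by (rule qcong_add)
  then show ?thesis by (simp add: qcong_def algebra_simps)
qed

lemma qcong_mult_left:
  assumes "qcong q f g"
  shows "qcong q (h * f) (h * g)"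
proof -
  obtain u v where "f - g = of_nat q * u + cyc * v" using assms by (auto simp: qcong_def)
  then have "h * f - h * g = of_nat q * (h * u) + cyc * (h * v)"
    by (simp add: right_diff_distrib[symmetric] distrib_left mult.left_commute)
  then show ?thesis by (rule qcongI)
qed

lemma qcong_smult: "qcong q f g \<Longrightarrow> qcong q (smult c f) (smult c g)"
  using qcong_mult_left[of q f g "[:c:]"] by simp

lemma qcong_mult: "qcong q f g \<Longrightarrow> qcong q f' g' \<Longrightarrow> qcong q (f * f') (g * g')"
  using qcong_mult_left qcong_trans by (metis mult.commute)

lemma qcong_power: "qcong q f g \<Longrightarrow> qcong q (f ^ n) (g ^ n)"
  by (induction n) (simp_all add: qcong_mult)

lemma qcong_sum: "(\<And>i. i \<in> I \<Longrightarrow> qcong q (f i) (g i)) \<Longrightarrow> qcong q (\<Sum>i\<in>I. f i) (\<Sum>i\<in>I. g i)"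
  by (induction I rule: infinite_finite_induct) (simp_all add: qcong_add)

section \<open>Group ring elements given by coefficient functions\<close>

definition \<zeta> :: "int \<Rightarrow> eis poly" where "\<zeta> i = monom 1 (nat (i mod int p))"

lemma zeta_mod [simp]: "\<zeta> (i mod int p) = \<zeta> i"
  by (simp add: \<zeta>_def)

lemma monom_qcong: "qcong q (monom 1 n) (\<zeta> (int n))"
proof -
  have "monom 1 n = monom (1 :: eis) p ^ (n div p) * monom 1 (n mod p)"
    by (simp add: monom_power mult_monom)
  moreover have "\<zeta> (int n) = 1 ^ (n div p) * monom 1 (n mod p)"
    by (simp add: \<zeta>_def zmod_int [symmetric])
  moreover have "qcong 0 (monom 1 p) 1"
    by (rule qcong_0I) (simp add: cyc_def)
  ultimately show ?thesis
    by (metis qcong_from_0 qcong_power qcong_mult qcong_refl)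
qed

lemma zeta_mult: "qcong q (\<zeta> i * \<zeta> j) (\<zeta> (i + j))"
proof -
  have "\<zeta> i * \<zeta> j = monom 1 (nat (i mod int p) + nat (j mod int p))"
    by (simp add: \<zeta>_def mult_monom)
  moreover have "\<zeta> (int (nat (i mod int p) + nat (j mod int p))) = \<zeta> (i + j)"
    using p_gt_1 by (simp add: \<zeta>_def mod_add_eq)
  ultimately show ?thesis using monom_qcong by metis
qed

lemma zeta_power: "qcong q (\<zeta> i ^ n) (\<zeta> (int n * i))"
proof (induction n)
  case 0
  then show ?case using monom_qcong[of q 0] by (simp add: one_pCons[symmetric] monom_0)
next
  case (Suc n)
  have "qcong q (\<zeta> i ^ Suc n) (\<zeta> i * \<zeta> (int n * i))"
    unfolding power_Suc using Suc.IH by (rule qcong_mult_left)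
  also have "qcong q \<dots> (\<zeta> (i + int n * i))" by (rule zeta_mult)
  finally show ?case by (simp add: algebra_simps)
qed

text \<open>The root of unity stays formal: substituting p-th roots of unity for x would give the
  finite Fourier transform of \<open>f\<close>.\<close>

definition fourier :: "(int \<Rightarrow> eis) \<Rightarrow> eis poly" where
  "fourier f = (\<Sum>i\<in>Zp. smult (f i) (\<zeta> i))"

lemma fourier_smult: "smult c (fourier f) = fourier (\<lambda>i. c * f i)"
proof -
  have "smult c (sum g I) = (\<Sum>i\<in>I. smult c (g i))" for g :: "int \<Rightarrow> eis poly" and I
    by (induction I rule: infinite_finite_induct) (simp_all add: smult_add_right)
  then show ?thesis by (simp add: fourier_def)
qed

text \<open>Multiplication in the group ring is convolution of coefficients; periodicity of
  \<open>g\<close> allows the reindexing j = c - i outside the range of summation.\<close>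

lemma fourier_mult:
  assumes "\<And>i. g (i mod int p) = g i"
  shows "qcong q (fourier f * fourier g) (fourier (\<lambda>c. \<Sum>i\<in>Zp. f i * g (c - i)))"
proof -
  have "fourier f * fourier g = (\<Sum>i\<in>Zp. \<Sum>j\<in>Zp. smult (f i * g j) (\<zeta> i * \<zeta> j))"
    by (simp add: fourier_def sum_product mult_ac)
  also have "qcong q \<dots> (\<Sum>i\<in>Zp. \<Sum>j\<in>Zp. smult (f i * g j) (\<zeta> (i + j)))"
    by (intro qcong_sum qcong_smult zeta_mult)
  also have "(\<Sum>i\<in>Zp. \<Sum>j\<in>Zp. smult (f i * g j) (\<zeta> (i + j))) =
      (\<Sum>i\<in>Zp. \<Sum>c\<in>Zp. smult (f i * g (c - i)) (\<zeta> c))"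
  proof (rule sum.cong[OF refl])
    fix i
    have per: "\<zeta> (i + j mod int p) = \<zeta> (i + j)" for j
      by (simp add: \<zeta>_def mod_add_right_eq)
    have "(\<Sum>c\<in>Zp. smult (f i * g (1 * c + - i)) (\<zeta> (i + (1 * c + - i)))) =
        (\<Sum>j\<in>Zp. smult (f i * g j) (\<zeta> (i + j)))"
      by (rule sum_Zp_affine) (simp_all add: assms per)
    then show "(\<Sum>j\<in>Zp. smult (f i * g j) (\<zeta> (i + j))) = (\<Sum>c\<in>Zp. smult (f i * g (c - i)) (\<zeta> c))"
      by simp
  qed
  also have "\<dots> = fourier (\<lambda>c. \<Sum>i\<in>Zp. f i * g (c - i))"
    by (subst sum.swap) (simp add: fourier_def smult_sum)
  finally show ?thesis .
qed

lemma not_dvd_of_mult_cong_1: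
  assumes "[x * y = 1] (mod int p)"
  shows "\<not> int p dvd x \<and> \<not> int p dvd y"
proof -
  have "\<not> int p dvd x * y"
  proof
    assume "int p dvd x * y"
    then have "[1 = 0] (mod int p)" using assms by (metis cong_0_iff cong_sym cong_trans)
    then show False by (simp add: cong_0_iff)
  qed
  then show ?thesis by auto
qed

text \<open>Modulo q the q-th power is taken termwise and moves the index i to q i;
  \<open>q'\<close>, the inverse of q modulo p, brings the indices back.\<close>

lemma fourier_frobenius:
  assumes "prime q" "[int q * q' = 1] (mod int p)" "\<And>i. f (i mod int p) = f i"
  shows "qcong q (fourier f ^ q) (fourier (\<lambda>c. f (q' * c) ^ q))"
proof -
  have unit: "\<not> int p dvd int q"
    using not_dvd_of_mult_cong_1[OF assms(2)] by blast
  have inv: "(q' * (int q * i + 0)) mod int p = i mod int p" for i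
  proof -
    have "[(int q * q') * i = 1 * i] (mod int p)" using assms(2) by (rule cong_scalar_right)
    then show ?thesis by (simp add: cong_def mult_ac)
  qed
  have "qcong q (fourier f ^ q) (\<Sum>i\<in>Zp. (smult (f i) (\<zeta> i)) ^ q)"
    unfolding fourier_def by (intro qcong_dvdI freshmans_dream_sum_dvd assms)
  also have "(\<Sum>i\<in>Zp. (smult (f i) (\<zeta> i)) ^ q) = (\<Sum>i\<in>Zp. smult (f i ^ q) (\<zeta> i ^ q))"
    by (simp add: smult_power)
  also have "qcong q \<dots> (\<Sum>i\<in>Zp. smult (f i ^ q) (\<zeta> (int q * i)))"
    by (intro qcong_sum qcong_smult zeta_power)
  also have "(\<Sum>i\<in>Zp. smult (f i ^ q) (\<zeta> (int q * i))) =
      (\<Sum>i\<in>Zp. smult (f (q' * (int q * i + 0)) ^ q) (\<zeta> (int q * i + 0)))"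
  proof (rule sum.cong[OF refl])
    fix i
    have "f (q' * (int q * i + 0)) = f i" using inv assms(3) by metis
    then show "smult (f i ^ q) (\<zeta> (int q * i)) =
        smult (f (q' * (int q * i + 0)) ^ q) (\<zeta> (int q * i + 0))" by simp
  qed
  also have "\<dots> = (\<Sum>i\<in>Zp. smult (f (q' * i) ^ q) (\<zeta> i))"
  proof (rule sum_Zp_affine[OF _ unit])
    fix a
    have "f (q' * (a mod int p)) = f (q' * a)" using assms(3) by (metis mod_mult_right_eq)
    then show "smult (f (q' * (a mod int p)) ^ q) (\<zeta> (a mod int p)) = smult (f (q' * a) ^ q) (\<zeta> a)"
      by simp
  qed
  finally show ?thesis by (simp add: fourier_def)
qed

text \<open>The functional reads off the coefficient of \<open>x\<close> modulo \<open>x ^ p - 1\<close>: on a multiple of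
  \<open>x ^ p - 1\<close> the sum telescopes.\<close>

lemma fourier_qcong_imp_dvd:
  assumes "qcong q (fourier f) (fourier g)"
  shows "of_nat q dvd f 1 - g 1"
proof -
  obtain u v where uv: "fourier f - fourier g = of_nat q * u + cyc * v"
    using assms by (auto simp: qcong_def)
  \<comment> \<open>With this \<open>n\<close> the one term that survives telescoping, the
    coefficient of \<open>v\<close> at 1 + n * p, lies beyond the degree of
    \<open>v\<close>.\<close>
  define n where "n = Suc (degree v)"
  define L where "L h = (\<Sum>k<Suc n. coeff h (1 + k * p))" for h :: "eis poly"
  have L_fourier: "L (fourier h) = h 1" for h
  proof -
    have "coeff (fourier h) (1 + k * p) = (if k = 0 then h 1 else 0)" for k
    proof -
      have "coeff (fourier h) (1 + k * p) = (\<Sum>i\<in>Zp. if nat i = 1 + k * p then h i else 0)"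
        by (simp add: fourier_def coeff_sum \<zeta>_def if_distrib cong: if_cong)
      also have "\<dots> = (\<Sum>i\<in>Zp. if i = 1 then (if k = 0 then h 1 else 0) else 0)"
      proof (rule sum.cong[OF refl])
        fix i assume i: "i \<in> Zp"
        have "nat i < 1 + k * p" if "k \<noteq> 0"
          using that i by (cases k) auto
        then show "(if nat i = 1 + k * p then h i else 0) = (if i = 1 then (if k = 0 then h 1 else 0) else 0)"
          using i by (cases "k = 0") auto
      qed
      finally show ?thesis using p_gt_1 by simp
    qed
    then show ?thesis by (simp add: L_def sum.lessThan_Suc_shift)
  qed
  have L_cyc: "L (cyc * v) = 0"
  proof -
    have "(\<Sum>k<m. coeff (cyc * v) (1 + k * p)) = (if m = 0 then 0 else - coeff v (1 + (m - 1) * p))" for m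
    proof (induction m)
      case (Suc m)
      have c: "coeff (cyc * v) (1 + m * p) = (if m = 0 then 0 else coeff v (1 + (m - 1) * p)) - coeff v (1 + m * p)"
        using p_gt_1 by (cases m) (simp_all add: cyc_def left_diff_distrib coeff_monom_mult)
      show ?case unfolding sum.lessThan_Suc Suc.IH c by simp
    qed simp
    then have "L (cyc * v) = - coeff v (1 + n * p)" by (simp add: L_def)
    moreover have "degree v < 1 + n * p"
    proof -
      have "n * 1 \<le> n * p" using p_gt_1 by (intro mult_le_mono2) simp
      then show ?thesis by (simp add: n_def)
    qed
    ultimately show ?thesis by (simp add: coeff_eq_0)
  qed
  have L_diff: "L (a - b) = L a - L b" and L_add: "L (a + b) = L a + L b" for a b
    by (simp_all add: L_def sum_subtractf sum.distrib del: sum.lessThan_Suc)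
  have "of_nat q * u = smult (of_nat q) u" by (simp add: of_nat_poly)
  then have L_q: "L (of_nat q * u) = of_nat q * L u"
    by (simp add: L_def sum_distrib_left del: sum.lessThan_Suc)
  have "f 1 - g 1 = L (fourier f - fourier g)" by (simp add: L_diff L_fourier)
  also have "\<dots> = of_nat q * L u" unfolding uv by (simp add: L_add L_cyc L_q)
  finally show ?thesis by simp
qed

section \<open>The Gauss sum and its powers\<close>

definition gauss :: "eis poly" where "gauss = fourier \<chi>"

lemma gauss_square: "qcong q (gauss * gauss) (smult J (fourier (\<lambda>c. eis_cnj (\<chi> c))))"
  using fourier_mult[of \<chi> q \<chi>] by (simp add: gauss_def conv_chi_chi fourier_smult)

lemma gauss_mult_cnj: "qcong q (gauss * fourier (\<lambda>c. eis_cnj (\<chi> c))) (fourier \<delta>)"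
  using fourier_mult[of "\<lambda>c. eis_cnj (\<chi> c)" q \<chi>] by (simp add: gauss_def conv_chi_cnj)

lemma delta_mod [simp]: "\<delta> (c mod int p) = \<delta> c"
  by (simp add: \<delta>_def dvd_mod_iff)

lemma gauss_mult_delta: "qcong q (gauss * fourier \<delta>) (smult (of_nat p) gauss)"
  using fourier_mult[of \<delta> q \<chi>] by (simp add: gauss_def conv_chi_delta fourier_smult)

text \<open>The classical g^3 = p J holds only up to the trivial character: the group ring has p - T
  in place of p.\<close>

lemma gauss_cube: "qcong q (gauss ^ 3) (smult J (fourier \<delta>))"
proof -
  have "qcong q (gauss * (gauss * gauss)) (gauss * smult J (fourier (\<lambda>c. eis_cnj (\<chi> c))))"
    by (intro qcong_mult_left gauss_square)
  also have "\<dots> = smult J (gauss * fourier (\<lambda>c. eis_cnj (\<chi> c)))" by simp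
  also have "qcong q \<dots> (smult J (fourier \<delta>))" by (intro qcong_smult gauss_mult_cnj)
  finally show ?thesis by (simp add: power3_eq_cube mult.assoc)
qed

text \<open>The spare Gauss sum, the 1 in the exponent, turns each factor p - T into p by
  \<open>gauss_mult_delta\<close>.\<close>

lemma gauss_power: "qcong q (gauss ^ (3 * n + 1)) (smult ((of_nat p * J) ^ n) gauss)"
proof (induction n)
  case (Suc n)
  have "gauss ^ (3 * Suc n + 1) = gauss ^ 3 * gauss ^ (3 * n + 1)"
    by (simp only: power_add [symmetric]) simp
  also have "qcong q \<dots> (smult J (fourier \<delta>) * smult ((of_nat p * J) ^ n) gauss)"
    by (intro qcong_mult gauss_cube Suc.IH)
  also have "\<dots> = smult (J * (of_nat p * J) ^ n) (gauss * fourier \<delta>)" by (simp add: mult_ac)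
  also have "qcong q \<dots> (smult (J * (of_nat p * J) ^ n) (smult (of_nat p) gauss))"
    by (intro qcong_smult gauss_mult_delta)
  finally show ?case by (simp add: mult_ac)
qed simp

text \<open>Write g' for the element with the conjugate coefficients and J' for the conjugate of J.
  Then g^2 = J g', g'^2 = J' g and g g' = p - T, so J J' g = J g'^2 = g^2 g' = p g.\<close>

lemma J_mult_cnj: "J * eis_cnj J = of_nat p"
proof -
  let ?G' = "fourier (\<lambda>c. eis_cnj (\<chi> c))"
  have conv: "(\<Sum>a\<in>Zp. eis_cnj (\<chi> a) * eis_cnj (\<chi> (c - a))) = eis_cnj J * \<chi> c" for c
    using arg_cong[OF conv_chi_chi[of c], of eis_cnj] by (simp add: eis_cnj_sum)
  have sq: "qcong 0 (?G' * ?G') (smult (eis_cnj J) gauss)"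
    using fourier_mult[of "\<lambda>c. eis_cnj (\<chi> c)" 0 "\<lambda>c. eis_cnj (\<chi> c)"]
    by (simp add: gauss_def conv fourier_smult)
  have "qcong 0 (smult J (smult (eis_cnj J) gauss)) (smult J (?G' * ?G'))"
    by (intro qcong_smult qcong_sym[OF sq])
  also have "\<dots> = ?G' * smult J ?G'" by simp
  also have "qcong 0 \<dots> (?G' * (gauss * gauss))"
    by (intro qcong_mult_left qcong_sym[OF gauss_square])
  also have "\<dots> = gauss * (gauss * ?G')" by (simp add: mult_ac)
  also have "qcong 0 \<dots> (gauss * fourier \<delta>)"
    by (intro qcong_mult_left gauss_mult_cnj)
  also have "qcong 0 \<dots> (smult (of_nat p) gauss)" by (rule gauss_mult_delta)
  finally have "qcong 0 (fourier (\<lambda>c. J * eis_cnj J * \<chi> c)) (fourier (\<lambda>c. of_nat p * \<chi> c))"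
    by (simp add: gauss_def fourier_smult mult.assoc)
  \<comment> \<open>Compare the coefficients at 1, where \<chi> is 1; divisibility by 0 is
    equality.\<close>
  from fourier_qcong_imp_dvd[OF this] show ?thesis by simp
qed

section \<open>Congruences for J and divisibility by J\<close>

lemma inverse_mod_p:
  assumes "prime q" "q \<noteq> p"
  obtains q' where "[int q * q' = 1] (mod int p)"
proof -
  have "coprime (int q) (int p)"
    using primes_coprime[OF assms(1) prime_p assms(2)] by simp
  then show ?thesis using that cong_solve_coprime_int by blast
qed

text \<open>For q = 3 the cube of the Gauss sum is itself a Frobenius power. Its coefficient at 1 is
  1 modulo 3, as nonzero values of \<chi> have cube 1, while \<open>gauss_cube\<close> gives
  -J.\<close>

lemma J_primary: "3 dvd J + 1"
proof -
  obtain q' where q': "[int 3 * q' = 1] (mod int p)"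
    using inverse_mod_p[of 3] p_neq_3 by auto
  have "\<not> int p dvd q'"
    using not_dvd_of_mult_cong_1[OF q'] by blast
  then have q'1: "\<chi> q' ^ 3 = 1" using chi_mu3 eis_mu3_power3 by blast
  have "qcong 3 (fourier (\<lambda>c. J * \<delta> c)) (gauss ^ 3)"
    unfolding fourier_smult[symmetric] by (rule qcong_sym[OF gauss_cube])
  also have "qcong 3 \<dots> (fourier (\<lambda>c. \<chi> (q' * c) ^ 3))"
    unfolding gauss_def by (rule fourier_frobenius) (use q' in auto)
  finally have "of_nat 3 dvd J * \<delta> 1 - \<chi> (q' * 1) ^ 3" by (rule fourier_qcong_imp_dvd)
  then have "3 dvd - (J + 1)" using q'1 by (simp add: \<delta>_def)
  then show ?thesis by (simp only: dvd_minus_iff)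
qed

text \<open>The product y of z and the conjugate of J is 0 under \<open>reduce\<close> modulo p, and
  so is the conjugate of y, which is a multiple of J. Together these make p = J * eis_cnj J divide
  y, and the conjugate of J cancels.\<close>

lemma J_dvd:
  assumes "int p dvd reduce z"
  shows "J dvd z"
proof -
  define y where "y = z * eis_cnj J"
  have "[reduce y = reduce z * reduce (eis_cnj J)] (mod int p)"
    unfolding y_def by (rule reduce_mult)
  then have r1: "int p dvd fst_eis y + r * snd_eis y"
    using assms unfolding reduce_def[symmetric] by (meson cong_dvd_iff dvd_mult2 cong_0_iff cong_trans)
  have "reduce (eis_cnj y) = reduce (eis_cnj z * J)" by (simp add: y_def)
  moreover have "[reduce (eis_cnj z * J) = reduce (eis_cnj z) * reduce J] (mod int p)"
    by (rule reduce_mult)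
  ultimately have "int p dvd reduce (eis_cnj y)"
    using reduce_J by (metis cong_0_iff cong_trans dvd_mult)
  then have r2: "int p dvd fst_eis y - snd_eis y - r * snd_eis y"
    by (simp add: reduce_def)
  have "int p dvd (fst_eis y + r * snd_eis y) - (fst_eis y - snd_eis y - r * snd_eis y)"
    using r1 r2 by (rule dvd_diff)
  also have "\<dots> = (2 * r + 1) * snd_eis y" by (simp add: algebra_simps)
  finally have s: "int p dvd snd_eis y"
    using differences_not_dvd(3) prime_int_p by (simp only: prime_dvd_mult_iff) simp
  then have "int p dvd (fst_eis y + r * snd_eis y) - r * snd_eis y"
    using r1 by (intro dvd_diff dvd_mult)
  then have "int p dvd fst_eis y" by simp
  then have "of_nat p dvd y" using s by (simp add: of_nat_dvd_eis_iff)
  then obtain t where "z * eis_cnj J = J * eis_cnj J * t"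
    unfolding y_def J_mult_cnj by (elim dvdE)
  then have "eis_cnj J * z = eis_cnj J * (J * t)" by (simp add: mult_ac)
  moreover have "eis_cnj J \<noteq> 0"
  proof
    assume "eis_cnj J = 0"
    then have "of_nat p = (0 :: eis)" using J_mult_cnj by simp
    then show False using p_gt_1 by simp
  qed
  ultimately show ?thesis by simp
qed

text \<open>The power g^(q^2) is computed twice. Two Frobenius steps give the coefficient
  \<chi>(q'^2)^(q^2) at 1, which is \<chi>(q) because q^2 is 1 modulo 3 and \<open>q'\<close>
  inverts q; \<open>gauss_power\<close> gives the power of p J.\<close>

lemma J_power:
  assumes "prime q" "q \<noteq> 3" "q \<noteq> p"
  shows "of_nat q dvd (of_nat p * J) ^ ((q\<^sup>2 - 1) div 3) - \<chi> (int q)"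
proof -
  obtain q' where q': "[int q * q' = 1] (mod int p)"
    using inverse_mod_p assms by blast
  have "\<not> 3 dvd q" using assms(1,2) primes_dvd_imp_eq[of 3 q] by auto
  define n where "n = (q\<^sup>2 - 1) div 3"
  have n: "q\<^sup>2 = 3 * n + 1"
    using three_dvd_square_minus_1[OF \<open>\<not> 3 dvd q\<close>] by (simp add: n_def)
  have chi_q: "\<chi> (int q) * \<chi> q' = 1"
    using chi_cong[OF q'] by (simp add: chi_mult)
  have not_dvd: "\<not> int p dvd q'"
    using chi_q chi_eq_0[of q'] by auto
  have "\<chi> (q' * q') = \<chi> (int q)"
  proof -
    have "\<chi> q' ^ 3 = 1" using not_dvd chi_mu3 eis_mu3_power3 by blast
    then have "\<chi> q' * \<chi> (q' * q') = \<chi> q' * \<chi> (int q)"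
      using chi_q by (simp add: chi_mult power3_eq_cube mult_ac)
    moreover have "\<chi> q' \<noteq> 0" using chi_q by auto
    ultimately show ?thesis by simp
  qed
  moreover have "\<chi> q' ^ (q\<^sup>2) = \<chi> q'"
  proof -
    have "\<chi> q' ^ 3 = 1" using not_dvd chi_mu3 eis_mu3_power3 by blast
    then show ?thesis unfolding n by (simp add: power_mult)
  qed
  ultimately have val: "(\<chi> (q' * (q' * 1)) ^ q) ^ q = \<chi> (int q)"
    by (metis mult.right_neutral chi_mult power_mult power_mult_distrib power2_eq_square)
  have "qcong q (gauss ^ q) (fourier (\<lambda>c. \<chi> (q' * c) ^ q))"
    unfolding gauss_def by (rule fourier_frobenius) (use q' assms in auto)
  then have "qcong q ((gauss ^ q) ^ q) ((fourier (\<lambda>c. \<chi> (q' * c) ^ q)) ^ q)"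
    by (rule qcong_power)
  also have "qcong q \<dots> (fourier (\<lambda>c. (\<chi> (q' * (q' * c)) ^ q) ^ q))"
  proof (rule fourier_frobenius[OF assms(1) q'])
    fix i
    have "\<chi> (q' * (i mod int p)) = \<chi> (q' * i)" by (simp add: chi_mult)
    then show "\<chi> (q' * (i mod int p)) ^ q = \<chi> (q' * i) ^ q" by simp
  qed
  finally have frob: "qcong q (gauss ^ (q\<^sup>2)) (fourier (\<lambda>c. (\<chi> (q' * (q' * c)) ^ q) ^ q))"
    by (simp add: power_mult power2_eq_square)
  have "qcong q (fourier (\<lambda>c. (of_nat p * J) ^ n * \<chi> c)) (gauss ^ (3 * n + 1))"
    unfolding fourier_smult[symmetric] gauss_def[symmetric] by (rule qcong_sym[OF gauss_power])
  also note n[symmetric]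
  also note frob
  finally have "of_nat q dvd (of_nat p * J) ^ n * \<chi> 1 - (\<chi> (q' * (q' * 1)) ^ q) ^ q"
    by (rule fourier_qcong_imp_dvd)
  then show ?thesis using val by (simp add: n_def)
qed

end

section \<open>Cubic reciprocity for rational primes\<close>

text \<open>If p divided b it would divide a as well, so b is invertible modulo p. Then r = -a/b is
  a root because b^2 (r^2 + r + 1) is the norm modulo p.\<close>

lemma eis_norm_root:
  assumes "prime p" "int p dvd eis_norm z" "\<not> of_nat p dvd z"
  obtains r where "int p dvd r\<^sup>2 + r + 1" "int p dvd fst_eis z + r * snd_eis z"
proof -
  define a b where "a = fst_eis z" and "b = snd_eis z"
  have N: "int p dvd a\<^sup>2 - a * b + b\<^sup>2" using assms(2) by (simp add: eis_norm_def a_def b_def)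
  have prime: "prime (int p)" using assms(1) by simp
  have b: "\<not> int p dvd b"
  proof
    assume pb: "int p dvd b"
    have "int p dvd (a\<^sup>2 - a * b + b\<^sup>2) - b * (b - a)"
      using N pb by (intro dvd_diff[OF _ dvd_mult2])
    then have "int p dvd a\<^sup>2" by (simp add: power2_eq_square algebra_simps)
    then have "int p dvd a" using prime prime_dvd_power by blast
    then show False using pb assms(3) by (simp add: of_nat_dvd_eis_iff a_def b_def)
  qed
  then have "coprime b (int p)"
    using prime_imp_coprime[OF prime] coprime_commute by blast
  then obtain b' where b': "[b * b' = 1] (mod int p)"
    using cong_solve_coprime_int by blast
  then obtain t where t: "b * b' - 1 = int p * t"
    unfolding cong_iff_dvd_diff by (elim dvdE)
  define r where "r = - a * b'"
  have rb: "r * b = - a - int p * (a * t)"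
  proof -
    have "r * b = - a * (b * b' - 1) - a" by (simp add: r_def algebra_simps)
    then show ?thesis unfolding t by (simp add: algebra_simps)
  qed
  have "b\<^sup>2 * (r\<^sup>2 + r + 1) = (r * b)\<^sup>2 + (r * b) * b + b\<^sup>2"
    by (simp add: power2_eq_square algebra_simps)
  also have "\<dots> = (a\<^sup>2 - a * b + b\<^sup>2) + int p * (a * t * (2 * a + int p * (a * t) - b))"
    unfolding rb by (simp add: power2_eq_square algebra_simps)
  finally have "int p dvd b\<^sup>2 * (r\<^sup>2 + r + 1)" using N by simp
  then have "int p dvd r\<^sup>2 + r + 1"
    using b prime by (simp add: prime_dvd_mult_iff prime_dvd_power_iff)
  moreover have "int p dvd a + r * b" unfolding rb by simp
  ultimately show ?thesis using that by (simp add: a_def b_def)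
qed

text \<open>Norm 1 bounds the second coordinate by 1 in absolute value, and being a multiple of 3 it
  vanishes. At the end of the descent on the norm this leaves only a sign undetermined.\<close>

lemma eis_unit_primary:
  assumes "eis_norm z = 1" "3 dvd z - 1 \<or> 3 dvd z + 1"
  shows "z = 1 \<or> z = - 1"
proof -
  have three: "3 dvd y \<longleftrightarrow> 3 dvd fst_eis y \<and> 3 dvd snd_eis y" for y :: eis
    using of_int_dvd_eis_iff[of 3 y] by simp
  have b3: "3 dvd snd_eis z" using assms(2) by (auto simp: three)
  have "3 * (snd_eis z)\<^sup>2 \<le> 4" using four_eis_norm[of z] assms(1) zero_le_power2[of "2 * fst_eis z - snd_eis z"]
    by linarith
  then have "\<bar>snd_eis z\<bar>\<^sup>2 < 2\<^sup>2" by simp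
  then have "\<bar>snd_eis z\<bar> < 2" by (rule power2_less_imp_less) simp
  then have b: "snd_eis z = 0" using b3 by presburger
  then have "(fst_eis z)\<^sup>2 = 1" using assms(1) by (simp add: eis_norm_def)
  then have "fst_eis z = 1 \<or> fst_eis z = - 1" by (simp add: power2_eq_1_iff)
  then show ?thesis using b by (auto simp: eis_eq_iff)
qed

lemma not_three_dvd_prime:
  assumes "prime (q :: nat)" "q \<noteq> 3"
  shows "\<not> 3 dvd q"
  using assms primes_dvd_imp_eq[of 3 q] by auto

lemma even_third_square_minus_1:
  assumes "prime (q :: nat)" "q \<noteq> 3" "q \<noteq> 2"
  shows "even ((q\<^sup>2 - 1) div 3)"
proof -
  have "odd q" using assms(1,3) prime_odd_nat[of q] prime_ge_2_nat[of q] by linarith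
  then have "odd (3 * ((q\<^sup>2 - 1) div 3) + 1)"
    using three_dvd_square_minus_1[OF not_three_dvd_prime[OF assms(1,2)]] by simp
  then show ?thesis by simp
qed

lemma dvd_mult_diff:
  fixes a b c d :: "'a :: comm_ring_1"
  assumes "m dvd a - b" "m dvd c - d"
  shows "m dvd a * c - b * d"
proof -
  have "a * c - b * d = (a - b) * c + b * (c - d)" by (simp add: algebra_simps)
  then show ?thesis using assms by simp
qed

text \<open>The sign left open by \<open>eis_unit_primary\<close> is invisible to the symbol: the
  exponent is even for odd q, and the signs agree modulo 2.\<close>

lemma neg_1_power_dvd:
  assumes "prime q" "q \<noteq> 3"
  shows "of_nat q dvd (- 1 :: eis) ^ ((q\<^sup>2 - 1) div 3) - 1"
proof (cases "q = 2")
  case True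
  then show ?thesis by (simp add: of_nat_dvd_eis_iff)
next
  case False
  then have "even ((q\<^sup>2 - 1) div 3)" using assms even_third_square_minus_1 by blast
  then show ?thesis by simp
qed

text \<open>The function \<open>F\<close> is the cubic residue symbol modulo \<open>z\<close>. Each prime divisor \<open>p\<close> of the norm
  contributes the factor \<open>p * J\<close> of \<open>z * N z\<close>; since all Jacobi sums are \<open>- 1\<close> modulo 3, the unit
  that is left over at the end is determined by \<open>z\<close> modulo 3.\<close>

lemma cubic_reciprocity:
  assumes "\<not> 3 dvd eis_norm z" "\<And>p. prime p \<Longrightarrow> \<not> of_nat p dvd z" "3 dvd z - 1 \<or> 3 dvd z + 1"
  shows "\<exists>F :: int \<Rightarrow> eis. (\<forall>x y. F (x * y) = F x * F y) \<and>
    (\<forall>x. (\<forall>p. prime p \<longrightarrow> int p dvd eis_norm z \<longrightarrow> \<not> int p dvd x) \<longrightarrow> F x \<in> eis_mu3) \<and>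
    (\<forall>x. (\<forall>p. prime p \<longrightarrow> int p dvd eis_norm z \<longrightarrow> (\<exists>y. \<not> int p dvd y \<and> [x = y ^ 3] (mod int p)))
      \<longrightarrow> F x = 1) \<and>
    (\<forall>q. prime q \<longrightarrow> q \<noteq> 3 \<longrightarrow> \<not> int q dvd eis_norm z \<longrightarrow>
      of_nat q dvd (z * of_int (eis_norm z)) ^ ((q\<^sup>2 - 1) div 3) - F (int q))"
  using assms
proof (induction "nat (eis_norm z)" arbitrary: z rule: less_induct)
  case less
  have norm_pos: "eis_norm z > 0"
    using eis_norm_nonneg[of z] less.prems(1) dvd_0_right[of 3] by (metis order_le_less)
  show ?case
  proof (cases "eis_norm z = 1")
    case True
    have "z = 1 \<or> z = - 1" using eis_unit_primary[OF True] less.prems(3) by blast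
    then have "of_nat q dvd (z * of_int (eis_norm z)) ^ ((q\<^sup>2 - 1) div 3) - 1"
      if "prime q" "q \<noteq> 3" for q
      using neg_1_power_dvd[OF that] True by auto
    then show ?thesis
      by (intro exI[of _ "\<lambda>_. 1"]) (auto simp: eis_mu3_def)
  next
    case False
    then have "nat (eis_norm z) \<noteq> 1" using norm_pos by simp
    then obtain p where p: "prime p" "p dvd nat (eis_norm z)"
      using prime_factor_nat by blast
    then have p_dvd: "int p dvd eis_norm z" using norm_pos dvd_nat_abs_iff[of p "eis_norm z"] by simp
    have "p \<noteq> 3" using p_dvd less.prems(1) by auto
    obtain r where r: "int p dvd r\<^sup>2 + r + 1" "int p dvd fst_eis z + r * snd_eis z"
      using eis_norm_root[OF p(1) p_dvd less.prems(2)[OF p(1)]] by blast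
    interpret S: cubic_residue_symbol p r
      by unfold_locales (use p r \<open>p \<noteq> 3\<close> in auto)
    have "S.J dvd z" using r(2) by (intro S.J_dvd) (simp add: S.reduce_def)
    then obtain z' where z: "z = S.J * z'" by (elim dvdE)
    have "of_int (eis_norm S.J) = (of_int (int p) :: eis)"
      using S.J_mult_cnj eis_mult_cnj[of S.J] by simp
    then have "eis_norm S.J = int p" by (simp only: of_int_eq_iff)
    then have norm: "eis_norm z = int p * eis_norm z'" by (simp add: z eis_norm_mult)
    have "eis_norm z' > 0" using norm_pos norm by (simp add: zero_less_mult_iff)
    then have "eis_norm z' < eis_norm z"
      using norm S.p_gt_1 by simp
    then have smaller: "nat (eis_norm z') < nat (eis_norm z)"
      using \<open>eis_norm z' > 0\<close> by simp
    \<comment> \<open>J is -1 modulo 3, hence z' is congruent to -z and again satisfies the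
      hypothesis modulo 3.\<close>
    obtain t where t: "S.J + 1 = 3 * t" using S.J_primary by (elim dvdE)
    have "z + z' = (S.J + 1) * z'" by (simp add: z algebra_simps)
    also have "\<dots> = 3 * (t * z')" unfolding t by simp
    finally have zt: "z = 3 * (t * z') - z'" by (simp only: eq_diff_eq)
    have "z' + 1 = 3 * (t * z') - (z - 1)" "z' - 1 = 3 * (t * z') - (z + 1)"
      unfolding zt by (simp_all add: algebra_simps)
    then have primary: "3 dvd z' - 1 \<or> 3 dvd z' + 1"
      using less.prems(3) by (metis dvd_diff dvd_triv_left)
    have "\<not> 3 dvd eis_norm z'" using less.prems(1) norm by auto
    moreover have "\<not> of_nat l dvd z'" if "prime l" for l
      using less.prems(2)[OF that] z dvd_mult by blast
    ultimately obtain F where F: "\<And>x y. F (x * y) = F x * F y"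
      "\<And>x. (\<forall>p. prime p \<longrightarrow> int p dvd eis_norm z' \<longrightarrow> \<not> int p dvd x) \<Longrightarrow> F x \<in> eis_mu3"
      "\<And>x. (\<forall>p. prime p \<longrightarrow> int p dvd eis_norm z' \<longrightarrow> (\<exists>y. \<not> int p dvd y \<and> [x = y ^ 3] (mod int p)))
        \<Longrightarrow> F x = 1"
      "\<And>q. prime q \<Longrightarrow> q \<noteq> 3 \<Longrightarrow> \<not> int q dvd eis_norm z' \<Longrightarrow>
        of_nat q dvd (z' * of_int (eis_norm z')) ^ ((q\<^sup>2 - 1) div 3) - F (int q)"
      using less.hyps[OF smaller _ _ primary] by blast
    show ?thesis
    proof (intro exI[of _ "\<lambda>x. S.\<chi> x * F x"] conjI allI impI)
      show "S.\<chi> (x * y) * F (x * y) = S.\<chi> x * F x * (S.\<chi> y * F y)" for x y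
        by (simp add: S.chi_mult F(1) mult_ac)
    next
      fix x assume x: "\<forall>p. prime p \<longrightarrow> int p dvd eis_norm z \<longrightarrow> \<not> int p dvd x"
      have "S.\<chi> x \<in> eis_mu3" using x p(1) p_dvd by (intro S.chi_mu3) blast
      moreover have "F x \<in> eis_mu3" using x norm by (intro F(2)) auto
      ultimately show "S.\<chi> x * F x \<in> eis_mu3" by (rule eis_mu3_mult)
    next
      fix x assume x: "\<forall>p. prime p \<longrightarrow> int p dvd eis_norm z \<longrightarrow>
        (\<exists>y. \<not> int p dvd y \<and> [x = y ^ 3] (mod int p))"
      obtain y where "\<not> int p dvd y" "[x = y ^ 3] (mod int p)" using x p(1) p_dvd by blast
      then have "S.\<chi> x = 1" using S.chi_cong S.chi_cube by metis
      moreover have "F x = 1" using x norm by (intro F(3)) auto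
      ultimately show "S.\<chi> x * F x = 1" by simp
    next
      fix q assume q: "prime q" "q \<noteq> 3" "\<not> int q dvd eis_norm z"
      then have "q \<noteq> p" "\<not> int q dvd eis_norm z'" using norm by auto
      then have "of_nat q dvd (of_nat p * S.J) ^ ((q\<^sup>2 - 1) div 3) *
          (z' * of_int (eis_norm z')) ^ ((q\<^sup>2 - 1) div 3) - S.\<chi> (int q) * F (int q)"
        using q by (intro dvd_mult_diff S.J_power F(4))
      moreover have "z * of_int (eis_norm z) = (of_nat p * S.J) * (z' * of_int (eis_norm z'))"
        unfolding norm by (simp add: z mult_ac)
      ultimately show "of_nat q dvd (z * of_int (eis_norm z)) ^ ((q\<^sup>2 - 1) div 3) - S.\<chi> (int q) * F (int q)"
        by (simp only: power_mult_distrib)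
    qed
  qed
qed

section \<open>Power computations for evaluating the symbol\<close>

lemma three_mult_third:
  assumes "prime (q :: nat)" "q \<noteq> 3"
  shows "3 * ((q\<^sup>2 - 1) div 3) = (q - 1) * (q + 1)"
proof -
  have "3 * ((q\<^sup>2 - 1) div 3) + 1 = q\<^sup>2"
    using three_dvd_square_minus_1[OF not_three_dvd_prime[OF assms]] .
  moreover have "q\<^sup>2 = (q - 1) * (q + 1) + 1"
    using prime_gt_0_nat[OF assms(1)] by (cases q) (simp_all add: power2_eq_square)
  ultimately show ?thesis by linarith
qed

lemma of_int_cong_dvd:
  assumes "[a = b] (mod int q)"
  shows "of_nat q dvd (of_int a - of_int b :: eis)"
  using assms by (simp add: cong_iff_dvd_diff of_nat_dvd_eis_iff)

text \<open>\<open>1 + 2 * \<omega>\<close> is a square root of -3, so the base squares to (-3)^3.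
  For odd q the whole power is -3 raised to a multiple of q - 1, and Fermat applies; q = 2 is
  checked directly.\<close>

lemma sqrt_minus_27_power:
  assumes "prime q" "q \<noteq> 3"
  shows "of_nat q dvd (3 * (1 + 2 * \<omega>)) ^ ((q\<^sup>2 - 1) div 3) - 1"
proof (cases "q = 2")
  case True
  have "(3 * (1 + 2 * \<omega>)) ^ 1 - 1 = of_nat 2 * Eis 1 3" by (simp add: eis_eq_iff)
  then show ?thesis using True by simp
next
  case False
  define m where "m = (q\<^sup>2 - 1) div 3"
  have "even m" using even_third_square_minus_1 assms False by (simp add: m_def)
  then obtain k where k: "m = 2 * k" by (elim evenE)
  have "odd q" using assms(1) False prime_odd_nat[of q] prime_ge_2_nat[of q] by linarith
  then obtain l where l: "q = 2 * l + 1" by (elim oddE)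
  have "3 * m = (q - 1) * (q + 1)" using three_mult_third[OF assms] by (simp add: m_def)
  then have k3: "3 * k = (q - 1) * (l + 1)" using k l by (simp add: algebra_simps)
  have "(3 * (1 + 2 * \<omega>))\<^sup>2 = of_int ((- 3) ^ 3)"
    by (simp add: eis_eq_iff power2_eq_square)
  then have "(3 * (1 + 2 * \<omega>)) ^ m = (of_int ((- 3) ^ 3)) ^ k"
    unfolding k power_mult by (rule arg_cong)
  also have "\<dots> = of_int ((- 3) ^ (3 * k))"
    by (simp only: of_int_power power_mult)
  also have "\<dots> = of_int ((- 3) ^ ((q - 1) * (l + 1)))" by (simp only: k3)
  finally have eq: "(3 * (1 + 2 * \<omega>)) ^ m = of_int ((- 3) ^ ((q - 1) * (l + 1)))" .
  have "\<not> int q dvd - 3" using not_dvd_three[OF assms] by simp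
  then have "[(- 3) ^ ((q - 1) * (l + 1)) = 1] (mod int q)"
    using fermat_int assms(1) by blast
  from of_int_cong_dvd[OF this] show ?thesis unfolding m_def[symmetric] eq by simp
qed

text \<open>With e(k) = (k^2 - 1)/3 one has e(mn) = e(m) + e(n) + 3 e(m) e(n), so e is additive
  modulo 3.\<close>

lemma third_square_minus_1_mult:
  assumes "\<not> 3 dvd (m :: nat)" "\<not> 3 dvd (n :: nat)"
  shows "\<omega> ^ (((m * n)\<^sup>2 - 1) div 3) = \<omega> ^ ((m\<^sup>2 - 1) div 3) * \<omega> ^ ((n\<^sup>2 - 1) div 3)"
proof -
  define e where "e k = (k\<^sup>2 - 1) div 3" for k :: nat
  have "\<not> 3 dvd m * n" using assms prime_dvd_mult_nat[of 3] by auto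
  then have mn: "3 * e (m * n) + 1 = m\<^sup>2 * n\<^sup>2" and m: "3 * e m + 1 = m\<^sup>2" and n: "3 * e n + 1 = n\<^sup>2"
    using three_dvd_square_minus_1 assms unfolding e_def power_mult_distrib[symmetric] by blast+
  have "3 * e (m * n) + 1 = (3 * e m + 1) * (3 * e n + 1)" unfolding mn m n ..
  then have "e (m * n) = 3 * (e m * e n) + (e m + e n)" by (simp add: algebra_simps)
  then have "\<omega> ^ e (m * n) = (\<omega> ^ 3) ^ (e m * e n) * (\<omega> ^ e m * \<omega> ^ e n)"
    by (simp only: power_add power_mult)
  then show ?thesis by (simp add: e_def)
qed

lemma omega_power_third_induct:
  fixes F :: "int \<Rightarrow> eis"
  assumes mult: "\<And>x y. F (x * y) = F x * F y" and "F 1 = 1"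
    and prime: "\<And>q. prime q \<Longrightarrow> q dvd N \<Longrightarrow> F (int q) = \<omega> ^ ((q\<^sup>2 - 1) div 3)"
    and "\<not> 3 dvd N"
  shows "n dvd N \<Longrightarrow> F (int n) = \<omega> ^ ((n\<^sup>2 - 1) div 3)"
proof (induction n rule: prime_divisors_induct)
  case zero
  then show ?case using assms(4) by simp
next
  case (unit n)
  then show ?case using assms(2) by simp
next
  case (factor q n)
  have "q dvd N" "n dvd N" using factor.prems by (auto dest: dvd_mult_left dvd_mult_right)
  moreover have "\<not> 3 dvd q" "\<not> 3 dvd n" using assms(4) calculation dvd_trans by blast+
  moreover have "F (int (q * n)) = F (int q) * F (int n)" by (simp add: mult)
  ultimately show ?case
    using factor.IH factor.hyps prime[of q] third_square_minus_1_mult[of q n] by simp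
qed

lemma exists_prime_not_cube:
  fixes A :: int
  assumes A3: "\<not> 3 dvd A" and A9: "\<not> [A\<^sup>2 = 1] (mod 9)" and "j > 0"
  obtains p where "prime p" "p \<noteq> 2" "int p dvd (A ^ (6 * j))\<^sup>2 + 3"
    "\<And>y. \<not> int p dvd y \<Longrightarrow> \<not> [A = y ^ 3] (mod int p)"
proof -
  define B where "B = A ^ (6 * j)"
  have "A mod 3 = 1 \<or> A mod 3 = 2" using A3 by (auto simp: dvd_eq_mod_eq_0)
  then have "A\<^sup>2 mod 3 = 1" by (auto simp: power2_eq_square mod_mult_eq[of A 3 A, symmetric])
  then have "[A\<^sup>2 = 1] (mod 3)" by (simp add: cong_def)
  then have "[(A\<^sup>2) ^ (3 * j) = 1 ^ (3 * j)] (mod 3)" by (rule cong_pow)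
  then have B1: "3 dvd B - 1" by (simp add: B_def power_mult [symmetric] cong_iff_dvd_diff)
  have parity: "even B \<longleftrightarrow> even A" using \<open>j > 0\<close> by (simp add: B_def)
  \<comment> \<open>These make c z = -2 + (B - 1)\<omega>, which is \<omega>(B + sqrt(-3)) with
    sqrt(-3) = 1 + 2\<omega>. For odd A the factor c = 2 is removed, so that z is divisible by no
    rational prime and has odd norm.\<close>
  obtain c d e where cde: "c * d = 2" "c * e = B - 1" "c = 1 \<and> d = 2 \<and> even A \<or> c = 2 \<and> d = 1 \<and> odd A"
  proof (cases "even A")
    case True
    then show thesis using that[of 1 2 "B - 1"] by simp
  next
    case False
    then have "2 * ((B - 1) div 2) = B - 1" using parity by simp
    then show thesis using that[of 2 1 "(B - 1) div 2"] False by simp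
  qed
  define z where "z = Eis (- d) e"
  define N where "N = eis_norm z"
  have "c\<^sup>2 * N = (c * d)\<^sup>2 + (c * d) * (c * e) + (c * e)\<^sup>2"
    by (simp add: N_def z_def eis_norm_def power2_eq_square algebra_simps)
  also have "\<dots> = B\<^sup>2 + 3" unfolding cde by (simp add: power2_eq_square algebra_simps)
  finally have cN: "c\<^sup>2 * N = B\<^sup>2 + 3" .
  have odd_e: "odd e" if "d = 2" using that cde parity by auto
  have "odd N"
    using cde(3) odd_e by (auto simp: N_def z_def eis_norm_def)
  have "\<not> 3 dvd N"
  proof
    assume "3 dvd N"
    then have "3 dvd c\<^sup>2 * N - 3" by (intro dvd_diff) simp_all
    then have "3 dvd B\<^sup>2" using cN by simp
    then have "3 dvd B" using prime_dvd_power[of "3 :: int" B 2] by simp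
    then have "3 dvd B - (B - 1)" using B1 by (rule dvd_diff)
    then show False by simp
  qed
  have primitive: "\<not> of_nat p dvd z" if "prime p" for p
  proof
    assume "of_nat p dvd z"
    then have "int p dvd d" "int p dvd e" by (simp_all add: of_nat_dvd_eis_iff z_def)
    moreover have "\<not> int p dvd 1" using prime_gt_1_nat[OF that] by simp
    ultimately have "d = 2" using cde(3) by auto
    then have "int p dvd int 2" using \<open>int p dvd d\<close> by simp
    then have "p = 2" using that primes_dvd_imp_eq[of p 2] by (simp only: of_nat_dvd_iff) simp
    then show False using odd_e[OF \<open>d = 2\<close>] \<open>int p dvd e\<close> by simp
  qed
  have "3 dvd c * e" using B1 cde(2) by simp
  moreover have "\<not> 3 dvd c" using cde(3) by auto
  ultimately have "3 dvd e" using prime_dvd_mult_iff[of "3 :: int" c e] by simp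
  \<comment> \<open>As 3 divides e, z is -d modulo 3, and d is 1 or 2.\<close>
  then have primary: "3 dvd z - 1 \<or> 3 dvd z + 1"
    using cde(3) of_int_dvd_eis_iff[of 3 "z - 1"] of_int_dvd_eis_iff[of 3 "z + 1"]
    by (auto simp: z_def)
  obtain F where F: "\<And>x y. F (x * y) = F x * F y"
    "\<And>x. (\<forall>p. prime p \<longrightarrow> int p dvd N \<longrightarrow> \<not> int p dvd x) \<Longrightarrow> F x \<in> eis_mu3"
    "\<And>x. (\<forall>p. prime p \<longrightarrow> int p dvd N \<longrightarrow> (\<exists>y. \<not> int p dvd y \<and> [x = y ^ 3] (mod int p)))
      \<Longrightarrow> F x = 1"
    "\<And>q. prime q \<Longrightarrow> q \<noteq> 3 \<Longrightarrow> \<not> int q dvd N \<Longrightarrow>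
      of_nat q dvd (z * of_int N) ^ ((q\<^sup>2 - 1) div 3) - F (int q)"
    using cubic_reciprocity[OF \<open>\<not> 3 dvd N\<close>[unfolded N_def] primitive primary] unfolding N_def by blast
  have F_cube: "F (y ^ 3) = 1" if "\<bar>y\<bar> = 1" for y
    using that by (intro F(3)) (auto intro!: exI[of _ y] simp: zdvd1_eq abs_if split: if_splits
        dest!: prime_gt_1_nat)
  \<comment> \<open>A common prime divisor of A and N divides B and B^2 + 3, hence 3.\<close>
  have coprime_A: "\<not> int p dvd N" if "prime p" "p \<noteq> 3" "int p dvd A" for p
  proof
    assume "int p dvd N"
    then have "int p dvd (B\<^sup>2 + 3)" unfolding cN[symmetric] by simp
    moreover have "int p dvd B"
      unfolding B_def using \<open>j > 0\<close> by (intro dvd_trans[OF that(3) dvd_power]) simp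
    then have "int p dvd B\<^sup>2" by (simp add: power2_eq_square)
    ultimately have "int p dvd 3" by (simp add: dvd_add_right_iff)
    then show False using not_dvd_three that by blast
  qed
  have at_prime: "F (int q) = \<omega> ^ ((q\<^sup>2 - 1) div 3)" if q: "prime q" "q dvd nat \<bar>A\<bar>" for q
  proof -
    define m where "m = (q\<^sup>2 - 1) div 3"
    have qA: "int q dvd A" using q(2) by (simp only: dvd_nat_abs_iff)
    then have "q \<noteq> 3" using A3 by auto
    have qB: "int q dvd B"
      unfolding B_def using \<open>j > 0\<close> by (intro dvd_trans[OF qA dvd_power]) simp
    have qN: "\<not> int q dvd N" using coprime_A[OF q(1) \<open>q \<noteq> 3\<close> qA] .
    have "\<not> int q dvd c"
    proof
      assume qc: "int q dvd c"
      then have "c = 2" using cde(3) prime_gt_1_nat[OF q(1)] by auto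
      then have "int q dvd int 2" using qc by simp
      then have "q = 2" using q(1) primes_dvd_imp_eq[of q 2] by (simp only: of_nat_dvd_iff) simp
      then show False using cde(3) \<open>c = 2\<close> qA by simp
    qed
    then have "[c ^ ((q - 1) * (q + 1)) = 1] (mod int q)" using fermat_int q(1) by blast
    then have "[(c ^ 3) ^ m = 1] (mod int q)"
      using three_mult_third[OF q(1) \<open>q \<noteq> 3\<close>] by (simp add: m_def power_mult [symmetric])
    from of_int_cong_dvd[OF this] have c1: "of_nat q dvd of_int (c ^ 3) ^ m - (1 :: eis)" by simp
    have "of_int c * z = Eis (- (c * d)) (c * e)" by (simp add: z_def eis_eq_iff)
    then have cz: "of_int c * z = Eis (- 2) (B - 1)" unfolding cde .
    \<comment> \<open>Multiplying by c^3 clears the denominator of z N and leaves the m-th power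
      unchanged modulo q. As q divides B, the product is 3(-2 - \<omega>) = 3(1 + 2\<omega>)\<omega>
      modulo q.\<close>
    have "of_int (c ^ 3) * (z * of_int N) = (of_int c * z) * of_int (c\<^sup>2 * N)"
      by (simp add: power2_eq_square power3_eq_cube mult_ac)
    also have "\<dots> = Eis (- 2) (B - 1) * of_int (B\<^sup>2 + 3)" by (simp only: cz cN)
    also have "of_nat q dvd \<dots> - 3 * (1 + 2 * \<omega>) * \<omega>"
    proof -
      have "Eis (- 2) (B - 1) * of_int (B\<^sup>2 + 3) - 3 * (1 + 2 * \<omega>) * \<omega> =
          of_int B * Eis (- 2 * B) (B\<^sup>2 + 3 - B)"
        by (simp add: eis_eq_iff power2_eq_square algebra_simps)
      moreover have "of_nat q dvd (of_int B :: eis)"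
        using qB by (simp add: of_nat_dvd_eis_iff)
      ultimately show ?thesis by simp
    qed
    finally have "of_nat q dvd (of_int (c ^ 3) * (z * of_int N)) ^ m - (3 * (1 + 2 * \<omega>) * \<omega>) ^ m"
      by (rule dvd_power_diff)
    then have d1: "of_nat q dvd of_int (c ^ 3) ^ m * (z * of_int N) ^ m - (3 * (1 + 2 * \<omega>)) ^ m * \<omega> ^ m"
      by (simp only: power_mult_distrib)
    have d2: "of_nat q dvd of_int (c ^ 3) ^ m * (z * of_int N) ^ m - 1 * F (int q)"
      using c1 F(4)[OF q(1) \<open>q \<noteq> 3\<close> qN] unfolding m_def by (rule dvd_mult_diff)
    have d3: "of_nat q dvd (3 * (1 + 2 * \<omega>)) ^ m * \<omega> ^ m - 1 * \<omega> ^ m"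
      using sqrt_minus_27_power[OF q(1) \<open>q \<noteq> 3\<close>] unfolding m_def by (rule dvd_mult_diff) simp
    have combine: "d dvd f - w" if "d dvd X - Y" "d dvd X - 1 * f" "d dvd Y - 1 * w" for d X Y f w :: eis
    proof -
      have "d dvd (X - Y) + (Y - 1 * w) - (X - 1 * f)" by (rule dvd_diff[OF dvd_add[OF that(1,3)] that(2)])
      then show ?thesis by simp
    qed
    have "of_nat q dvd F (int q) - \<omega> ^ m" using d1 d2 d3 by (rule combine)
    moreover have "F (int q) \<in> eis_mu3"
    proof (intro F(2) allI impI notI)
      fix p assume p: "prime p" "int p dvd N" "int p dvd int q"
      then have "p = q" using q(1) primes_dvd_imp_eq[of p q] by simp
      then show False using p qN by simp
    qed
    ultimately show ?thesis using eis_mu3_eqI[OF _ omega_power_mu3] q(1) by (simp add: m_def)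
  qed
  have "\<not> 3 dvd nat \<bar>A\<bar>"
  proof
    assume "3 dvd nat \<bar>A\<bar>"
    then have "int 3 dvd A" by (simp only: dvd_nat_abs_iff)
    then show False using A3 by simp
  qed
  have "F (int (nat \<bar>A\<bar>)) = \<omega> ^ (((nat \<bar>A\<bar>)\<^sup>2 - 1) div 3)"
    by (rule omega_power_third_induct[of F "nat \<bar>A\<bar>", OF F(1) _ at_prime])
      (use F_cube[of 1] \<open>\<not> 3 dvd nat \<bar>A\<bar>\<close> in simp_all)
  moreover have "F (int (nat \<bar>A\<bar>)) = F A"
  proof -
    have "F (- 1) = 1" using F_cube[of "- 1"] by simp
    then have "F (- A) = F A" using F(1)[of "- 1" A] by simp
    then show ?thesis by (simp add: abs_if)
  qed
  ultimately have FA: "F A = \<omega> ^ (((nat \<bar>A\<bar>)\<^sup>2 - 1) div 3)" by simp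
  \<comment> \<open>The exponent of \<omega> is a multiple of 3 only if 9 divides A^2 - 1. So the
    criterion for \<open>F A = 1\<close> must fail at some prime divisor of N.\<close>
  have "F A \<noteq> 1"
  proof
    assume "F A = 1"
    then have "3 dvd ((nat \<bar>A\<bar>)\<^sup>2 - 1) div 3" using FA omega_power_eq_1_iff by simp
    then obtain k where "((nat \<bar>A\<bar>)\<^sup>2 - 1) div 3 = 3 * k" by (elim dvdE)
    then have "(nat \<bar>A\<bar>)\<^sup>2 = 9 * k + 1"
      using three_dvd_square_minus_1[OF \<open>\<not> 3 dvd nat \<bar>A\<bar>\<close>] by simp
    then have "int ((nat \<bar>A\<bar>)\<^sup>2) = 9 * int k + 1" by simp
    then have "A\<^sup>2 = 9 * int k + 1" by simp
    then show False using A9 by (simp add: cong_iff_dvd_diff)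
  qed
  then obtain p where p: "prime p" "int p dvd N" "\<And>y. \<not> int p dvd y \<Longrightarrow> \<not> [A = y ^ 3] (mod int p)"
    using F(3)[of A] by blast
  have "p \<noteq> 2" using p(2) \<open>odd N\<close> by auto
  moreover have "int p dvd B\<^sup>2 + 3" using p(2) unfolding cN[symmetric] by simp
  ultimately show ?thesis using that p unfolding B_def by blast
qed

section \<open>Orders modulo primes\<close>

lemma rat_ord_of_int:
  assumes "prime p"
  shows "rat_ord p (of_int a) = ord p (nat (a mod int p))"
  using prime_gt_1_nat[OF assms] by (simp add: rat_ord_def rat_residue_def)

lemma padic_unit_of_int:
  assumes "prime p"
  shows "padic_unit p (of_int a) \<longleftrightarrow> \<not> int p dvd a"
  using prime_gt_1_nat[OF assms] by (simp add: padic_unit_def)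

lemma int_nat_mod_cong:
  assumes "prime p"
  shows "[int (nat (a mod int p)) = a] (mod int p)"
  using prime_gt_0_nat[OF assms] by (simp add: cong_def)

lemma rat_ord_of_int_dvd_iff:
  assumes "prime p"
  shows "rat_ord p (of_int a) dvd d \<longleftrightarrow> [a ^ d = 1] (mod int p)"
proof -
  define s where "s = nat (a mod int p)"
  have "rat_ord p (of_int a) dvd d \<longleftrightarrow> [s ^ d = 1] (mod p)"
    unfolding rat_ord_of_int[OF assms] s_def[symmetric] by (simp only: ord_divides)
  also have "\<dots> \<longleftrightarrow> [int s ^ d = 1] (mod int p)"
    using cong_int_iff[of "s ^ d" 1 p] by simp
  also have "\<dots> \<longleftrightarrow> [a ^ d = 1] (mod int p)"
    using cong_pow[OF int_nat_mod_cong[OF assms, of a], of d] unfolding s_def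
    by (metis cong_sym cong_trans)
  finally show ?thesis .
qed

text \<open>The order divides p - 1 > 0, which excludes the default value 0.\<close>

lemma rat_ord_of_int_pos:
  assumes "prime p" "\<not> int p dvd a"
  shows "rat_ord p (of_int a) > 0"
proof -
  have "rat_ord p (of_int a) dvd p - 1"
    using fermat_int[OF assms, of 1] rat_ord_of_int_dvd_iff[OF assms(1)] by simp
  then show ?thesis using prime_gt_1_nat[OF assms(1)] by (auto intro!: Nat.gr0I)
qed

text \<open>The product form avoids division; with a = A and b = -3 the gcd is the ratio of the two
  orders.\<close>

lemma rat_ord_of_int_power:
  assumes "prime p" "[b = a ^ k] (mod int p)"
  shows "rat_ord p (of_int b) * gcd k (rat_ord p (of_int a)) = rat_ord p (of_int a)"
proof -
  have "[int (nat (b mod int p)) = int (nat (a mod int p) ^ k)] (mod int p)"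
    using int_nat_mod_cong[OF assms(1), of b] assms(2)
      cong_pow[OF int_nat_mod_cong[OF assms(1), of a], of k]
    unfolding of_nat_power by (meson cong_sym cong_trans)
  then have "[nat (b mod int p) = nat (a mod int p) ^ k] (mod p)"
    by (simp only: cong_int_iff)
  then show ?thesis
    unfolding rat_ord_of_int[OF assms(1)] using ord_power_aux ord_cong by metis
qed

text \<open>If \<open>n\<close> is the order of \<open>a\<close> and 3 does not divide \<open>n\<close>, then \<open>a = a ^ (1 + 2 * n\<^sup>2)\<close>
  with an exponent divisible by 3.\<close>

lemma three_dvd_rat_ord:
  assumes "prime p" "\<not> int p dvd a" "\<And>y. \<not> int p dvd y \<Longrightarrow> \<not> [a = y ^ 3] (mod int p)"
  shows "3 dvd rat_ord p (of_int a)"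
proof (rule ccontr)
  define n where "n = rat_ord p (of_int a)"
  assume "\<not> 3 dvd rat_ord p (of_int a)"
  then have "3 * ((n\<^sup>2 - 1) div 3) + 1 = n\<^sup>2"
    unfolding n_def by (rule three_dvd_square_minus_1)
  then obtain k where "n\<^sup>2 = 3 * k + 1" by metis
  then have k: "1 + n * (2 * n) = (2 * k + 1) * 3" by (simp add: power2_eq_square)
  have "[a ^ (n * (2 * n)) = 1] (mod int p)"
    using rat_ord_of_int_dvd_iff[OF assms(1), of a "n * (2 * n)"] by (simp add: n_def)
  then have "[a * a ^ (n * (2 * n)) = a * 1] (mod int p)" by (rule cong_scalar_left)
  moreover have "a * a ^ (n * (2 * n)) = (a ^ (2 * k + 1)) ^ 3"
    unfolding power_mult[symmetric] k[symmetric] by simp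
  ultimately have "[a = (a ^ (2 * k + 1)) ^ 3] (mod int p)" by (simp add: cong_sym)
  moreover have "\<not> int p dvd a ^ (2 * k + 1)"
  proof
    assume "int p dvd a ^ (2 * k + 1)"
    moreover have "prime (int p)" using assms(1) by simp
    ultimately show False using assms(2) prime_dvd_power by blast
  qed
  ultimately show False using assms(3) by blast
qed

lemma exists_large_prime:
  fixes A :: int
  assumes A3: "\<not> 3 dvd A" and A9: "\<not> [A\<^sup>2 = 1] (mod 9)"
  shows "\<exists>p > M. prime p \<and> \<not> int p dvd 3 * A \<and>
    (\<exists>k > 0. rat_ord p (of_int A) = 3 * k * rat_ord p (of_int (- 3)))"
proof -
  define B where "B = A ^ (6 * fact M)"
  obtain p where p: "prime p" "p \<noteq> 2" "int p dvd B\<^sup>2 + 3"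
    "\<And>y. \<not> int p dvd y \<Longrightarrow> \<not> [A = y ^ 3] (mod int p)"
    using exists_prime_not_cube[OF A3 A9, of "fact M"] unfolding B_def by auto
  have prime: "prime (int p)" using p(1) by simp
  have "p \<noteq> 3"
  proof
    assume "p = 3"
    then have "3 dvd B\<^sup>2" using p(3) by (simp add: dvd_add_left_iff)
    then have "3 dvd A" unfolding B_def
      using prime_dvd_power[of "3 :: int" B 2] prime_dvd_power[of "3 :: int" A] B_def by simp
    then show False using A3 by blast
  qed
  then have p3: "\<not> int p dvd 3" using not_dvd_three p(1) by blast
  have pA: "\<not> int p dvd A"
  proof
    assume "int p dvd A"
    then have "int p dvd B" unfolding B_def by (rule dvd_trans[OF _ dvd_power]) simp
    then have "int p dvd B\<^sup>2" by (simp add: power2_eq_square)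
    then show False using p(3) p3 by (simp add: dvd_add_right_iff)
  qed
  have "p > M"
  proof (rule ccontr)
    assume "\<not> p > M"
    \<comment> \<open>For p at most M, p - 1 divides M!, and Fermat gives B^2 = 1 modulo p. Then p
      divides 4, contrary to p being odd.\<close>
    then have "p - 1 dvd fact M" using prime_gt_1_nat[OF p(1)] by (intro dvd_fact) auto
    then obtain t where t: "fact M = (p - 1) * t" by (elim dvdE)
    have "[A ^ ((p - 1) * (12 * t)) = 1] (mod int p)" using fermat_int p(1) pA by blast
    moreover have "A ^ ((p - 1) * (12 * t)) = B\<^sup>2"
      unfolding B_def t by (simp add: power_mult [symmetric] mult_ac)
    ultimately have "int p dvd B\<^sup>2 - 1" by (simp add: cong_iff_dvd_diff)
    then have "int p dvd (B\<^sup>2 + 3) - (B\<^sup>2 - 1)" using p(3) by (intro dvd_diff[of _ "B\<^sup>2 + 3"])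
    then have "int p dvd 2 ^ 2" by simp
    then have "int p dvd int 2" using prime prime_dvd_power[of "int p" 2 2] by simp
    then have "p dvd 2" by (simp only: of_nat_dvd_iff)
    then show False using p(1,2) primes_dvd_imp_eq[of p 2] by simp
  qed
  define n where "n = rat_ord p (of_int A)"
  define g where "g = gcd (12 * fact M) n"
  have "3 dvd n" unfolding n_def by (rule three_dvd_rat_ord[OF p(1) pA p(4)])
  then have "3 dvd g" unfolding g_def by (intro gcd_greatest) (auto simp: dvd_mult2)
  then obtain k where k: "g = 3 * k" by (elim dvdE)
  have "n > 0" unfolding n_def by (rule rat_ord_of_int_pos[OF p(1) pA])
  then have "g > 0" by (simp add: g_def)
  have "[- 3 = A ^ (12 * fact M)] (mod int p)"
  proof -
    have "A ^ (12 * fact M) = B\<^sup>2" unfolding B_def by (simp add: power_mult [symmetric])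
    then have "A ^ (12 * fact M) - - 3 = B\<^sup>2 + 3" by simp
    then have "[A ^ (12 * fact M) = - 3] (mod int p)" using p(3) by (simp only: cong_iff_dvd_diff)
    then show ?thesis by (rule cong_sym)
  qed
  then have "rat_ord p (of_int (- 3)) * g = n"
    unfolding g_def n_def by (rule rat_ord_of_int_power[OF p(1)])
  then have "rat_ord p (of_int A) = 3 * k * rat_ord p (of_int (- 3))"
    unfolding k n_def by (simp only: mult.commute)
  moreover have "k > 0" using \<open>g > 0\<close> k by simp
  moreover have "\<not> int p dvd 3 * A" using p3 pA prime by (simp add: prime_dvd_mult_iff)
  ultimately show ?thesis using \<open>p > M\<close> p(1) by blast
qed

theorem theorem1p3:
  fixes A :: int
  assumes "\<not> 3 dvd A"
    and "\<not> [A\<^sup>2 = 1] (mod 9)"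
  shows "infinite {p :: nat. prime p \<and> \<not> int p dvd 3 * A \<and>
           (\<exists>k :: int. real (rat_ord p (of_int A)) / real (rat_ord p (-3)) = of_int (3 * k))}
         \<and> order_dominant (of_int A) (-3)
         \<and> order_dominant (of_int A) 3"
proof -
  \<comment> \<open>The ratio is kept as a natural multiple: k > 0 will yield the strict
    inequalities, the product form the quotient.\<close>
  define S where "S = {p :: nat. prime p \<and> \<not> int p dvd 3 * A \<and>
    (\<exists>k > 0. rat_ord p (of_int A) = 3 * k * rat_ord p (of_int (- 3)))}"
  have "infinite S"
    unfolding infinite_nat_iff_unbounded S_def using exists_large_prime[OF assms] by blast
  have S: "prime p" "\<not> int p dvd 3 * A" "\<not> int p dvd 3" "\<not> int p dvd A"
    "rat_ord p (of_int (- 3)) > 0" if "p \<in> S" for p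
  proof -
    show p: "prime p" "\<not> int p dvd 3 * A" using that by (auto simp: S_def)
    then show p3: "\<not> int p dvd 3" "\<not> int p dvd A" by auto
    show "rat_ord p (of_int (- 3)) > 0" using p p3 by (intro rat_ord_of_int_pos) simp_all
  qed
  have ratio: "\<exists>k :: int. real (rat_ord p (of_int A)) / real (rat_ord p (-3)) = of_int (3 * k)"
    if p: "p \<in> S" for p
  proof -
    obtain k where "rat_ord p (of_int A) = 3 * k * rat_ord p (of_int (- 3))"
      using p by (auto simp: S_def)
    then show ?thesis using S(5)[OF p] by (intro exI[of _ "int k"]) simp
  qed
  have less: "rat_ord p (of_int 3) < rat_ord p (of_int A) \<and> rat_ord p (of_int (- 3)) < rat_ord p (of_int A)"
    if p: "p \<in> S" for p
  proof -
    define n where "n = rat_ord p (of_int (- 3))"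
    \<comment> \<open>An even exponent hides the sign, so the order of 3 is at most twice that of
      -3, whereas the order of A is at least three times it.\<close>
    have "[(- 3) ^ (n * 2) = 1] (mod int p)"
      using rat_ord_of_int_dvd_iff[OF S(1)[OF p], of "- 3" "n * 2"] unfolding n_def by simp
    then have "[3 ^ (n * 2) = 1] (mod int p)" by simp
    then have "rat_ord p (of_int 3) dvd n * 2"
      using rat_ord_of_int_dvd_iff[OF S(1)[OF p]] by blast
    then have "rat_ord p (of_int 3) \<le> n * 2"
      using S(5)[OF p] by (intro dvd_imp_le) (simp_all add: n_def)
    moreover obtain k where k: "k > 0" "rat_ord p (of_int A) = 3 * k * n"
      using p by (auto simp: S_def n_def)
    then have "3 * n \<le> rat_ord p (of_int A)" by simp
    ultimately show ?thesis using S(5)[OF p] unfolding n_def[symmetric] by linarith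
  qed
  have "A \<noteq> 0" "A \<noteq> 1" "A \<noteq> - 1" using assms by auto
  then have A_notin: "(of_int A :: rat) \<notin> {0, 1, -1}"
    by (metis insert_iff empty_iff of_int_0 of_int_1 of_int_minus of_int_eq_iff)
  have dominant: "order_dominant (of_int A) (of_int b)" if b: "b = 3 \<or> b = - 3" for b
  proof -
    have "S \<subseteq> {p. prime p \<and> padic_unit p (of_int A) \<and> padic_unit p (of_int b) \<and>
        rat_ord p (of_int A) > rat_ord p (of_int b)}"
    proof
      fix p assume p: "p \<in> S"
      have "\<not> int p dvd b" using S(3)[OF p] b by auto
      then show "p \<in> {p. prime p \<and> padic_unit p (of_int A) \<and> padic_unit p (of_int b) \<and>
          rat_ord p (of_int A) > rat_ord p (of_int b)}"
        using S(1,4)[OF p] less[OF p] b padic_unit_of_int[OF S(1)[OF p]] by blast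
    qed
    then have "infinite {p. prime p \<and> padic_unit p (of_int A) \<and> padic_unit p (of_int b) \<and>
        rat_ord p (of_int A) > rat_ord p (of_int b)}"
      using \<open>infinite S\<close> infinite_super by blast
    then show ?thesis using A_notin b unfolding order_dominant_def by auto
  qed
  have "S \<subseteq> {p :: nat. prime p \<and> \<not> int p dvd 3 * A \<and>
      (\<exists>k :: int. real (rat_ord p (of_int A)) / real (rat_ord p (-3)) = of_int (3 * k))}"
    using S(1,2) ratio by blast
  then show ?thesis
    using \<open>infinite S\<close> infinite_super dominant[of 3] dominant[of "- 3"] by auto
qed

end
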